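(* Let $m,n,r$ be positive integers with $r<\min\{m,n\}$, let $f:\mathbb{R}^{m\times n}\to\mathbb{R}$ be differentiable with $\nabla f$ locally Lipschitz continuous, let $0<\underline{\alpha}\le\bar{\alpha}<\infty$, $\beta,c\in(0,1)$, $\Delta\in(0,\infty)$, and $X_0\in\mathbb{R}^{m\times n}_{\le r}$. Let $(X_i)_{i\in\mathbb{N}}$ be an (infinite) sequence produced by the algorithm $\mathrm{RFDR}$ from $X_0$, i.e., for every $i\in\mathbb{N}$, $\mathrm{s}(X_i;f,\mathbb{R}^{m\times n}_{\le r})>0$ and $X_{i+1}\in\mathrm{RFDR}(X_i;f,r,\underline{\alpha},\bar{\alpha},\beta,c,\Delta)$. Then: (1) The sequence has at least one accumulation point if and only if $\liminf_{i\to\infty}\|X_i\|<\infty$. (2) For every convergent subsequence $(X_{i_k})_{k\in\mathbb{N}}$, $\lim_{k\to\infty}\mathrm{s}(X_{i_k};f,\mathbb{R}^{m\times n}_{\le r})=0$. (3) If $(X_i)_{i\in\mathbb{N}}$ is bounded, which is the case notably if the sublevel set $\{X\in\mathbb{R}^{m\times n}_{\le r}\mid f(X)\le f(X_0)\}$ is bounded, then $\lim_{i\to\infty}\mathrm{s}(X_i;f,\mathbb{R}^{m\times n}_{\le r})=0$, and all accumulation points of $(X_i)_{i\in\mathbb{N}}$ have the same image by $f$.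
   Context: $\mathbb{N}$ includes $0$. $\mathbb{R}^{m\times n}$ carries the Frobenius inner product $\langle\cdot,\cdot\rangle$ and norm $\|\cdot\|$. $\mathbb{R}^{m\times n}_{\le r}:=\{X\in\mathbb{R}^{m\times n}\mid \operatorname{rank}X\le r\}$ and $\mathbb{R}^{m\times n}_{k}:=\{X\mid\operatorname{rank}X=k\}$. $\sigma_1(X)\ge\sigma_2(X)\ge\dots$ are the singular values of $X$. For a nonempty set $S\subseteq\mathbb{R}^{m\times n}$, $P_S(Z):=\operatorname{argmin}_{Y\in S}\|Z-Y\|$ is the (set-valued) metric projection of $Z$ onto $S$; when $S$ is a closed cone, all elements of $P_S(Z)$ have the same norm, denoted $\|P_S(Z)\|$. Tangent cone and restricted tangent cone. Let $X\in\mathbb{R}^{m\times n}_{\le r}$ have rank $\underline{r}\ge1$, and let $[U\;U_\perp]\in\mathbb{R}^{m\times m}$ and $[V\;V_\perp]\in\mathbb{R}^{n\times n}$ be orthogonal matrices such that the columns of $U\in\mathbb{R}^{m\times\underline{r}}$ span $\operatorname{im}X$ and those of $V\in\mathbb{R}^{n\times\underline{r}}$ span $\operatorname{im}X^\top$. The tangent cone $T_{\mathbb{R}^{m\times n}_{\le r}}(X)$ is the set of all matrices $[U\;U_\perp]\begin{bmatrix}A&B\\C&D\end{bmatrix}[V\;V_\perp]^\top$ with $A\in\mathbb{R}^{\underline{r}\times\underline{r}}$, $B\in\mathbb{R}^{\underline{r}\times(n-\underline{r})}$, $C\in\mathbb{R}^{(m-\underline{r})\times\underline{r}}$, $D\in\mathbb{R}^{(m-\underline{r})\times(n-\underline{r})}$,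 $\operatorname{rank}D\le r-\underline{r}$. The restricted tangent cone $\breve{T}_{\mathbb{R}^{m\times n}_{\le r}}(X)$ is the subset of those matrices for which, in addition, $B=0$ or $C=0$. For $X=0$, both cones are $\mathbb{R}^{m\times n}_{\le r}$. These cones do not depend on the choice of $U,U_\perp,V,V_\perp$. Stationarity measure: $\mathrm{s}(X;f,\mathbb{R}^{m\times n}_{\le r}):=\|P_{T_{\mathbb{R}^{m\times n}_{\le r}}(X)}(-\nabla f(X))\|$ for $X\in\mathbb{R}^{m\times n}_{\le r}$. RFD map: $\mathrm{RFD}(X;f,r,\underline{\alpha},\bar{\alpha},\beta,c)$ is the set of all points that can be produced from $X\in\mathbb{R}^{m\times n}_{\le r}$ as follows: choose $G\in P_{\breve{T}_{\mathbb{R}^{m\times n}_{\le r}}(X)}(-\nabla f(X))$ and $\alpha\in[\underline{\alpha},\bar{\alpha}]$; while $f(X+\alpha G)>f(X)-c\,\alpha\|G\|^2$, replace $\alpha$ by $\alpha\beta$; return $X+\alpha G$. (If $G=0$, the output is $X$.) RFDR map: $\mathrm{RFDR}(X;f,r,\underline{\alpha},\bar{\alpha},\beta,c,\Delta)$ is the set of all points that can be produced from $X\in\mathbb{R}^{m\times n}_{\le r}$ as follows: choose $\tilde{X}\in\mathrm{RFD}(X;f,r,\underline{\alpha},\bar{\alpha},\beta,c)$. If $\sigma_r(X)\in(0,\Delta]$, choose $\hat{X}\in P_{\mathbb{R}^{m\times n}_{r-1}}(X)$, choose $\tilde{X}^{\mathrm{R}}\in\mathrm{RFD}(\hat{X};f,r,\underline{\alpha},\bar{\alpha},\beta,c)$,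 and return some $Y\in\operatorname{argmin}_{\{\tilde{X},\tilde{X}^{\mathrm{R}}\}}f$; otherwise return $\tilde{X}$. *)

theory Defs
  imports "HOL-Analysis.Analysis" "HOL-Library.While_Combinator"
begin

text \<open>The space of real m by n matrices is \<open>real^'n^'m\<close>; its inner product and norm in the library
  are the Frobenius ones.\<close>

definition rank_le :: "nat \<Rightarrow> (real^'n^'m) set" where
  "rank_le r = {X. rank X \<le> r}"

definition rank_eq :: "nat \<Rightarrow> (real^'n^'m) set" where
  "rank_eq k = {X. rank X = k}"

definition metric_projection :: "'a::real_normed_vector set \<Rightarrow> 'a \<Rightarrow> 'a set" where
  "metric_projection S Z = {Y. is_arg_min (\<lambda>W. norm (Z - W)) (\<lambda>W. W \<in> S) Y}"

text \<open>The common norm of all projections of a point. It is meaningful when the projection is nonempty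
  and all its elements have the same norm, as is the case for closed cones.\<close>

definition projection_norm :: "'a::real_normed_vector set \<Rightarrow> 'a \<Rightarrow> real" where
  "projection_norm S Z = (THE a. norm ` metric_projection S Z = {a})"

definition gradient :: "('a::real_inner \<Rightarrow> real) \<Rightarrow> 'a \<Rightarrow> 'a" where
  "gradient f x = (THE D. GDERIV f x :> D)"

definition locally_Lipschitz :: "('a::metric_space \<Rightarrow> 'b::metric_space) \<Rightarrow> bool" where
  "locally_Lipschitz F \<longleftrightarrow> (\<forall>x. \<exists>\<epsilon>>0. \<exists>L. L-lipschitz_on (ball x \<epsilon>) F)"

text \<open>A (thin) singular value decomposition
  \<open>X = \<sigma>\<^sub>1 u\<^sub>1 v\<^sub>1\<^sup>T + \<dots> + \<sigma>\<^sub>p u\<^sub>p v\<^sub>p\<^sup>T\<close> with \<open>p = min m n\<close>, indexed from 1.\<close>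

definition is_svd ::
    "real^'n^'m \<Rightarrow> (nat \<Rightarrow> real^'m) \<Rightarrow> (nat \<Rightarrow> real) \<Rightarrow> (nat \<Rightarrow> real^'n) \<Rightarrow> bool" where
  "is_svd X u \<sigma> v \<longleftrightarrow>
    (let K = {1..min CARD('m) CARD('n)} in
      (\<forall>k\<in>K. \<forall>l\<in>K. u k \<bullet> u l = (if k = l then 1 else 0)) \<and>
      (\<forall>k\<in>K. \<forall>l\<in>K. v k \<bullet> v l = (if k = l then 1 else 0)) \<and>
      (\<forall>k\<in>K. 0 \<le> \<sigma> k) \<and>
      (\<forall>k\<in>K. \<forall>l\<in>K. k \<le> l \<longrightarrow> \<sigma> l \<le> \<sigma> k) \<and>
      X = (\<Sum>k\<in>K. \<sigma> k *\<^sub>R (\<chi> i j. u k $ i * v k $ j)))"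

text \<open>The \<open>k\<close>-th largest singular value, for \<open>1 \<le> k \<le> min m n\<close> (every matrix has a singular value
  decomposition, and the values in it are unique).\<close>

definition singular_value :: "nat \<Rightarrow> real^'n^'m \<Rightarrow> real" where
  "singular_value k X = (THE s. \<exists>u \<sigma> v. is_svd X u \<sigma> v \<and> s = \<sigma> k)"

text \<open>A block decomposition \<open>[U U\<^sub>\<bottom>] [A B; C D] [V V\<^sub>\<bottom>]\<^sup>T\<close> is encoded by square orthogonal matrices
  \<open>P\<close>, \<open>Q\<close> and sets of column indices \<open>I\<close>, \<open>J\<close>: the columns of \<open>P\<close> with index in \<open>I\<close> are those of \<open>U\<close>,
  the others those of \<open>U\<^sub>\<bottom>\<close>, and likewise for \<open>Q\<close>, \<open>J\<close>. A block of the middle matrix \<open>M\<close> is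
  represented by \<open>M\<close> with all entries outside the block set to zero, which does not change its rank.\<close>

definition block :: "'m set \<Rightarrow> 'n set \<Rightarrow> real^'n^'m \<Rightarrow> real^'n^'m" where
  "block I J M = (\<chi> i j. if i \<in> I \<and> j \<in> J then M $ i $ j else 0)"

definition adapted_basis :: "(real^'m) set \<Rightarrow> real^'m^'m \<Rightarrow> 'm set \<Rightarrow> bool" where
  "adapted_basis S P I \<longleftrightarrow> orthogonal_matrix P \<and> span ((\<lambda>i. column i P) ` I) = S"

text \<open>The two cones do not depend on the adapted bases, so all of them are admitted. The definitions
  are meant for \<open>rank X \<le> r\<close>.\<close>

definition tangent_cone :: "nat \<Rightarrow> real^'n^'m \<Rightarrow> (real^'n^'m) set" where
  "tangent_cone r X =
    (if X = 0 then rank_le r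
     else {P ** M ** transpose Q | P I Q J M.
            adapted_basis (range ((*v) X)) P I \<and>
            adapted_basis (range ((*v) (transpose X))) Q J \<and>
            rank (block (- I) (- J) M) \<le> r - rank X})"

definition restricted_tangent_cone :: "nat \<Rightarrow> real^'n^'m \<Rightarrow> (real^'n^'m) set" where
  "restricted_tangent_cone r X =
    (if X = 0 then rank_le r
     else {P ** M ** transpose Q | P I Q J M.
            adapted_basis (range ((*v) X)) P I \<and>
            adapted_basis (range ((*v) (transpose X))) Q J \<and>
            rank (block (- I) (- J) M) \<le> r - rank X \<and>
            (block I (- J) M = 0 \<or> block (- I) J M = 0)})"

definition stationarity :: "nat \<Rightarrow> (real^'n^'m \<Rightarrow> real) \<Rightarrow> real^'n^'m \<Rightarrow> real" where
  "stationarity r f X = projection_norm (tangent_cone r X) (- gradient f X)"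

definition RFD ::
    "(real^'n^'m \<Rightarrow> real) \<Rightarrow> nat \<Rightarrow> real \<Rightarrow> real \<Rightarrow> real \<Rightarrow> real \<Rightarrow> real^'n^'m \<Rightarrow> (real^'n^'m) set"
  where
  "RFD f r \<alpha>lo \<alpha>hi \<beta> c X =
    {X + \<alpha>' *\<^sub>R G | G \<alpha> \<alpha>'.
      G \<in> metric_projection (restricted_tangent_cone r X) (- gradient f X) \<and>
      \<alpha> \<in> {\<alpha>lo..\<alpha>hi} \<and>
      while_option (\<lambda>a. f (X + a *\<^sub>R G) > f X - c * a * (norm G)\<^sup>2) (\<lambda>a. a * \<beta>) \<alpha> = Some \<alpha>'}"

definition RFDR ::
    "(real^'n^'m \<Rightarrow> real) \<Rightarrow> nat \<Rightarrow> real \<Rightarrow> real \<Rightarrow> real \<Rightarrow> real \<Rightarrow> real \<Rightarrow> real^'n^'m \<Rightarrow> (real^'n^'m) set"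
  where
  "RFDR f r \<alpha>lo \<alpha>hi \<beta> c \<Delta> X =
    {Y. \<exists>X1 \<in> RFD f r \<alpha>lo \<alpha>hi \<beta> c X.
      if singular_value r X \<in> {0<..\<Delta>}
      then \<exists>Xhat \<in> metric_projection (rank_eq (r - 1)) X.
             \<exists>X2 \<in> RFD f r \<alpha>lo \<alpha>hi \<beta> c Xhat. is_arg_min f (\<lambda>W. W \<in> {X1, X2}) Y
      else Y = X1}"

definition accumulation_point :: "(nat \<Rightarrow> 'a::topological_space) \<Rightarrow> 'a \<Rightarrow> bool" where
  "accumulation_point X L \<longleftrightarrow> (\<exists>\<phi>. strict_mono \<phi> \<and> (X \<circ> \<phi>) \<longlonglongrightarrow> L)"

end

theory Submission
  imports Defs
begin

text \<open>Every step lowers \<open>f\<close>, and near any given point \<open>Z\<close> a step from \<open>X\<close> lowers \<open>f\<close> by at least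
  \<open>\<kappa> s(X)\<^sup>2\<close>, where \<open>s\<close> is the stationarity measure and \<open>\<kappa> > 0\<close> depends on \<open>Z\<close> but not
  on \<open>X\<close> (\<open>RFD_local_decrease\<close>). This gives everything: if a subsequence converges to \<open>Z\<close>, the values of \<open>f\<close> along the
  whole decreasing sequence converge to \<open>f Z\<close>, so the single decreases tend to 0 and so does \<open>s\<close> along the
  subsequence (\<open>descent_along_convergent_subsequence\<close>). In particular all accumulation points have the same value.
  For a bounded sequence, \<open>s\<close> tends to 0 along the whole sequence by compactness. A bounded sublevel set of
  the feasible set bounds the sequence because the iterates stay in it.

  The local decrease has two ingredients. The first is geometric: with \<open>E\<close> and \<open>F\<close> the orthogonal projections
  onto the complements of the column and row spaces of \<open>X\<close>, the cones become
  \<open>rank (E G F) \<le> r - rank X\<close>, for the restricted cone together with \<open>G F = E G F\<close> or \<open>E G = E G F\<close>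
  (\<open>tangent_cone_eq\<close>, \<open>restricted_tangent_cone_eq\<close>). From this one reads off that the tangent cone is closed,
  that steps along the restricted cone keep the rank at most \<open>r\<close> (\<open>rank_restricted_step_le\<close>), and that the search
  direction \<open>G\<close> satisfies \<open>norm G \<ge> s(X) / 2\<close> (\<open>norm_tangent_projection_le\<close>). The second is the line search:
  since the gradient is Lipschitz near \<open>Z\<close>, rejected step sizes are bounded below (\<open>rejected_step_size_bound\<close>), hence so
  are the accepted ones, and the sufficient decrease condition yields a multiple of \<open>(norm G)\<^sup>2\<close>.\<close>

(* Products transpose A *v x stay in this form, in which they visibly lie in the row space of A. *)
declare transpose_matrix_vector [simp del]

section \<open>Rank and inner product of matrices\<close>

text \<open>Cauchy-Schwarz on each row: the operator norm is at most the Frobenius norm.\<close>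

lemma norm_matrix_vector_mult_le:
  fixes A :: "real^'n^'m"
  shows "norm (A *v x) \<le> norm A * norm x"
proof -
  have "norm (A *v x) = L2_set (\<lambda>i. \<bar>A $ i \<bullet> x\<bar>) UNIV"
    by (simp add: norm_vec_def matrix_mult_dot)
  also have "\<dots> \<le> L2_set (\<lambda>i. norm (A $ i) * norm x) UNIV"
    by (intro L2_set_mono Cauchy_Schwarz_ineq2) auto
  also have "\<dots> = norm A * norm x"
    by (simp add: norm_vec_def L2_set_left_distrib)
  finally show ?thesis .
qed

lemma bounded_bilinear_matrix_mult:
  "bounded_bilinear ((**) :: real^'k^'m \<Rightarrow> real^'n^'k \<Rightarrow> real^'n^'m)"
proof (rule bilinear_conv_bounded_bilinear[THEN iffD1], unfold bilinear_def, intro conjI allI linearI)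
  fix A B :: "real^'k^'m" and C :: "real^'n^'k" and a :: real
  show "(A + B) ** C = A ** C + B ** C"
    by (simp add: matrix_matrix_mult_def vec_eq_iff sum.distrib distrib_right)
  show "(a *\<^sub>R A) ** C = a *\<^sub>R (A ** C)"
    by (simp add: scalar_matrix_assoc)
next
  fix A :: "real^'k^'m" and B C :: "real^'n^'k" and a :: real
  show "A ** (B + C) = A ** B + A ** C"
    by (rule matrix_add_ldistrib)
  show "A ** (a *\<^sub>R B) = a *\<^sub>R (A ** B)"
    by (simp add: matrix_scalar_ac scalar_matrix_assoc)
qed

interpretation matrix_mult: bounded_bilinear "(**) :: real^'k^'m \<Rightarrow> real^'n^'k \<Rightarrow> real^'n^'m"
  by (rule bounded_bilinear_matrix_mult)

lemma subspace_range_matrix: "subspace (range ((*v) (A :: real^'n^'m)))"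
  by (intro linear_subspace_image matrix_vector_mul_linear subspace_UNIV)

lemma inner_matrix_mult_left:
  fixes A :: "real^'k^'m" and B :: "real^'n^'k"
  shows "(A ** B) \<bullet> C = B \<bullet> (transpose A ** C)"
proof -
  have "(A ** B) \<bullet> C = (\<Sum>i\<in>UNIV. \<Sum>j\<in>UNIV. \<Sum>k\<in>UNIV. A $ i $ k * B $ k $ j * C $ i $ j)"
    by (simp add: inner_vec_def matrix_matrix_mult_def sum_distrib_right)
  also have "\<dots> = (\<Sum>i\<in>UNIV. \<Sum>k\<in>UNIV. \<Sum>j\<in>UNIV. A $ i $ k * B $ k $ j * C $ i $ j)"
    by (intro sum.cong refl sum.swap)
  also have "\<dots> = (\<Sum>k\<in>UNIV. \<Sum>i\<in>UNIV. \<Sum>j\<in>UNIV. A $ i $ k * B $ k $ j * C $ i $ j)"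
    by (rule sum.swap)
  also have "\<dots> = (\<Sum>k\<in>UNIV. \<Sum>j\<in>UNIV. \<Sum>i\<in>UNIV. A $ i $ k * B $ k $ j * C $ i $ j)"
    by (intro sum.cong refl sum.swap)
  also have "\<dots> = B \<bullet> (transpose A ** C)"
    by (simp add: inner_vec_def matrix_matrix_mult_def transpose_def sum_distrib_left mult_ac)
  finally show ?thesis .
qed

lemma inner_transpose:
  fixes A B :: "real^'n^'m"
  shows "transpose A \<bullet> transpose B = A \<bullet> B"
  unfolding inner_vec_def transpose_def by (simp add: sum.swap[of _ "UNIV :: 'm set"])

lemma inner_matrix_mult_right:
  fixes A :: "real^'k^'m" and B :: "real^'n^'k"
  shows "(A ** B) \<bullet> C = A \<bullet> (C ** transpose B)"
proof -
  have "(A ** B) \<bullet> C = (transpose B ** transpose A) \<bullet> transpose C"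
    by (metis inner_transpose matrix_transpose_mul)
  also have "\<dots> = transpose A \<bullet> transpose (C ** transpose B)"
    by (simp add: inner_matrix_mult_left matrix_transpose_mul)
  finally show ?thesis
    by (simp add: inner_transpose)
qed

lemma rank_add_le:
  fixes A B :: "real^'n^'m"
  shows "rank (A + B) \<le> rank A + rank B"
proof -
  let ?S = "range ((*v) A)" and ?T = "range ((*v) B)"
  have S: "subspace ?S" and T: "subspace ?T"
    by (rule subspace_range_matrix)+
  have "range ((*v) (A + B)) \<subseteq> {x + y |x y. x \<in> ?S \<and> y \<in> ?T}"
    by (auto simp: matrix_vector_mult_add_rdistrib)
  then have "rank (A + B) \<le> dim {x + y |x y. x \<in> ?S \<and> y \<in> ?T}"
    unfolding rank_dim_range by (rule dim_subset)
  also have "\<dots> \<le> rank A + rank B"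
    using dim_sums_Int[OF S T] by (simp add: rank_dim_range)
  finally show ?thesis .
qed

lemma rank_scaleR_le:
  fixes A :: "real^'n^'m"
  shows "rank (a *\<^sub>R A) \<le> rank A"
proof -
  have "range ((*v) (a *\<^sub>R A)) \<subseteq> range ((*v) A)"
  proof clarify
    fix x
    have "(a *\<^sub>R A) *v x = A *v (a *\<^sub>R x)"
      by (simp add: matrix_vector_mult_scaleR scaleR_matrix_vector_assoc)
    then show "(a *\<^sub>R A) *v x \<in> range ((*v) A)" by blast
  qed
  then show ?thesis
    unfolding rank_dim_range by (rule dim_subset)
qed

text \<open>Lower semicontinuity of the rank. A matrix \<open>X\<close> is bounded below by some \<open>e > 0\<close> on its row space, so every
  matrix at Frobenius distance less than \<open>e\<close> stays injective there and has at least the same rank.\<close>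

lemma open_rank_gt:
  "open {X :: real^'n^'m. k < rank X}"
proof (unfold open_dist, intro ballI)
  fix X :: "real^'n^'m"
  assume "X \<in> {X. k < rank X}"
  then have k: "k < rank X" by simp
  let ?S = "range ((*v) (transpose X))"
  have S: "subspace ?S"
    by (rule subspace_range_matrix)
  have inj: "\<forall>x\<in>?S. X *v x = 0 \<longrightarrow> x = 0"
  proof (intro ballI impI)
    fix x assume "x \<in> ?S" and 0: "X *v x = 0"
    then obtain y where y: "x = transpose X *v y" by blast
    have "x \<bullet> x = y \<bullet> (X *v x)"
      unfolding y by (metis dot_lmul_matrix transpose_matrix_vector)
    with 0 show "x = 0" by simp
  qed
  obtain e where e: "e > 0" "\<And>x. x \<in> ?S \<Longrightarrow> e * norm x \<le> norm (X *v x)"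
    using injective_imp_isometric[OF closed_subspace[OF S] S matrix_vector_mul_bounded_linear inj]
    by blast
  show "\<exists>e>0. \<forall>Z. dist Z X < e \<longrightarrow> Z \<in> {X. k < rank X}"
  proof (intro exI conjI allI impI)
    show "e > 0" by fact
    fix Z assume Z: "dist Z X < e"
    have injZ: "x = 0" if "x \<in> ?S" "Z *v x = 0" for x
    proof (rule ccontr)
      assume "x \<noteq> 0"
      have "e * norm x \<le> norm ((X - Z) *v x)"
        using e(2)[OF that(1)] that(2) by (simp add: matrix_vector_mult_diff_rdistrib)
      also have "\<dots> \<le> norm (X - Z) * norm x"
        by (rule norm_matrix_vector_mult_le)
      finally show False
        using Z \<open>x \<noteq> 0\<close> by (simp add: dist_norm norm_minus_commute)
    qed
    have "inj_on ((*v) Z) ?S"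
    proof (rule inj_onI)
      fix x y assume "x \<in> ?S" "y \<in> ?S" "Z *v x = Z *v y"
      then show "x = y"
        using injZ[of "x - y"] subspace_diff[OF S] by (simp add: matrix_vector_mult_diff_distrib)
    qed
    then have "dim ?S = dim ((*v) Z ` ?S)"
      using S by (subst dim_image_eq[OF matrix_vector_mul_linear]) (simp_all add: span_eq_iff[THEN iffD2])
    also have "\<dots> \<le> rank Z"
      unfolding rank_dim_range by (intro dim_subset) auto
    finally show "Z \<in> {X. k < rank X}"
      using k rank_dim_range[of "transpose X"] rank_transpose[of X] by simp
  qed
qed


lemma closed_rank_le: "closed (rank_le k :: (real^'n^'m) set)"
proof -
  have "rank_le k = - {X :: real^'n^'m. k < rank X}"
    by (auto simp: rank_le_def)
  then show ?thesis
    using open_rank_gt[of k] by (simp add: closed_def)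
qed

section \<open>Projections onto orthogonal complements\<close>

text \<open>The matrix of the orthogonal projection onto the orthogonal complement of \<open>S\<close>. It depends on \<open>S\<close> only, and
  this is what makes the cones independent of the adapted bases.\<close>

definition complement_projector :: "(real^'m) set \<Rightarrow> real^'m^'m" where
  "complement_projector S =
    (THE E. \<forall>x. x - E *v x \<in> S \<and> (\<forall>y\<in>S. orthogonal (E *v x) y))"

lemma complement_projector_eqI:
  assumes S: "subspace S"
    and E: "\<And>x. x - E *v x \<in> S" "\<And>x y. y \<in> S \<Longrightarrow> orthogonal (E *v x) y"
  shows "complement_projector S = E"
  unfolding complement_projector_def
proof (rule the_equality)
  fix E' assume E': "\<forall>x. x - E' *v x \<in> S \<and> (\<forall>y\<in>S. orthogonal (E' *v x) y)"
  have "E' *v x = E *v x" for x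
  proof -
    \<comment> \<open>The difference of two such projections lies in \<open>S\<close> and is orthogonal to \<open>S\<close>.\<close>
    let ?d = "E' *v x - E *v x"
    have "?d = (x - E *v x) - (x - E' *v x)" by simp
    then have "?d \<in> S"
      using E E' S subspace_diff by metis
    then have "orthogonal ?d ?d"
      using E(2) E' by (auto simp: orthogonal_def inner_diff_left)
    then show ?thesis
      by (simp add: orthogonal_self)
  qed
  then show "E' = E"
    by (simp add: matrix_eq)
qed (use E in auto)

lemma block_mat_1_mult_nth:
  fixes M :: "real^'n^'m"
  shows "(block I I (mat 1) ** M) $ i $ j = (if i \<in> I then M $ i $ j else 0)"
proof -
  have "(block I I (mat 1) ** M) $ i $ j
      = (\<Sum>k\<in>UNIV. if k = i then (if i \<in> I then M $ i $ j else 0) else 0)"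
    unfolding matrix_matrix_mult_def block_def mat_def vec_lambda_beta by (rule sum.cong) auto
  then show ?thesis
    by (simp only: sum.delta finite UNIV_I if_True)
qed

lemma mult_block_mat_1_nth:
  fixes M :: "real^'n^'m"
  shows "(M ** block J J (mat 1)) $ i $ j = (if j \<in> J then M $ i $ j else 0)"
proof -
  have "(M ** block J J (mat 1)) $ i $ j
      = (\<Sum>k\<in>UNIV. if k = j then (if j \<in> J then M $ i $ j else 0) else 0)"
    unfolding matrix_matrix_mult_def block_def mat_def vec_lambda_beta by (rule sum.cong) auto
  then show ?thesis
    by (simp only: sum.delta finite UNIV_I if_True)
qed

text \<open>Restricting to a block is a product with coordinate projections, so it commutes with the change of bases.\<close>

lemma block_eq_mult:
  fixes M :: "real^'n^'m"
  shows "block I J M = block I I (mat 1) ** M ** block J J (mat 1)"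
  by (simp add: vec_eq_iff mult_block_mat_1_nth block_mat_1_mult_nth) (simp add: block_def)

lemma adapted_basis_exists:
  fixes S :: "(real^'m) set"
  assumes S: "subspace S"
  shows "\<exists>P I. adapted_basis S P I"
proof -
  let ?T = "{x. \<forall>y\<in>S. orthogonal y x}"
  obtain B where B: "B \<subseteq> S" "pairwise orthogonal B" "\<And>x. x \<in> B \<Longrightarrow> norm x = 1"
    "independent B" "card B = dim S" "span B = S"
    by (rule orthonormal_basis_subspace[OF S]) blast
  obtain C where C: "C \<subseteq> ?T" "pairwise orthogonal C" "\<And>x. x \<in> C \<Longrightarrow> norm x = 1"
    "independent C" "card C = dim ?T" "span C = ?T"
    by (rule orthonormal_basis_subspace[OF subspace_orthogonal_to_vectors[of S]]) blast
  have BC: "pairwise orthogonal (B \<union> C)"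
  proof (rule pairwiseI)
    fix x y assume xy: "x \<in> B \<union> C" "y \<in> B \<union> C" "x \<noteq> y"
    have "orthogonal b c" "orthogonal c b" if "b \<in> B" "c \<in> C" for b c
      using that B(1) C(1) by (auto simp: orthogonal_commute[of c])
    then show "orthogonal x y"
      using xy B(2) C(2) by (auto simp: pairwise_def)
  qed
  have norm1: "norm x = 1" if "x \<in> B \<union> C" for x
    using that B(3) C(3) by blast
  have ind: "independent (B \<union> C)"
    using norm1[of 0] by (intro pairwise_orthogonal_independent[OF BC]) auto
  have "x \<in> span (B \<union> C)" for x
  proof -
    obtain y z where "y \<in> span S" "\<And>w. w \<in> span S \<Longrightarrow> orthogonal z w" "x = y + z"
      using orthogonal_subspace_decomp_exists[of S x] by blast
    then have "y \<in> span B" "z \<in> span C"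
      unfolding B(6) C(6) span_eq_iff[THEN iffD2, OF S] by (auto simp: orthogonal_commute)
    then show ?thesis
      using \<open>x = y + z\<close> span_mono[of B "B \<union> C"] span_mono[of C "B \<union> C"]
      by (blast intro: span_add)
  qed
  then have "card (B \<union> C) = CARD('m)"
    using basis_card_eq_dim[OF subset_UNIV _ ind] by auto
  then obtain h where h: "bij_betw h (UNIV :: 'm set) (B \<union> C)"
    using finite_same_card_bij[OF finite_class.finite_UNIV independent_imp_finite[OF ind]] by auto
  \<comment> \<open>The orthonormal bases of \<open>S\<close> and of its complement together provide the columns of \<open>P\<close>.\<close>
  define P :: "real^'m^'m" where "P = (\<chi> i j. h j $ i)"
  have col: "column j P = h j" for j
    by (simp add: P_def column_def vec_eq_iff)
  have hBC: "h j \<in> B \<union> C" for j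
    using h by (auto simp: bij_betw_def)
  have "orthogonal (h i) (h j)" if "i \<noteq> j" for i j
    using that pairwiseD[OF BC hBC hBC] h by (auto simp: bij_betw_def inj_on_def)
  then have "orthogonal_matrix P"
    unfolding orthogonal_matrix_orthonormal_columns col using norm1[OF hBC] by blast
  moreover have "h ` (h -` B) = B"
    using h by (auto simp: bij_betw_def)
  ultimately have "adapted_basis S P (h -` B)"
    using B(6) by (simp add: adapted_basis_def col)
  then show ?thesis by blast
qed


text \<open>In an adapted basis the projection onto the complement keeps the coordinates with index outside \<open>I\<close> and
  erases the others.\<close>

lemma adapted_basis_projects:
  fixes P :: "real^'m^'m"
  assumes "adapted_basis S P I"
  defines "E \<equiv> P ** block (- I) (- I) (mat 1) ** transpose P"
  shows "x - E *v x \<in> S" "y \<in> S \<Longrightarrow> orthogonal (E *v x) y"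
proof -
  let ?D = "block (- I) (- I) (mat 1) :: real^'m^'m"
  let ?E = "P ** ?D ** transpose P"
  have P: "orthogonal_matrix P" and span: "span ((\<lambda>i. column i P) ` I) = S"
    using assms by (auto simp: adapted_basis_def)
  have PP: "transpose P ** P = mat 1" "P ** transpose P = mat 1"
    using P by (auto simp: orthogonal_matrix_def)
  have D: "(?D *v w) $ i = (if i \<in> I then 0 else w $ i)" for w i
  proof -
    have "(?D *v w) $ i = (\<Sum>k\<in>UNIV. if k = i then (if i \<in> I then 0 else w $ i) else 0)"
      unfolding matrix_vector_mult_def block_def mat_def vec_lambda_beta by (rule sum.cong) auto
    then show ?thesis
      by (simp only: sum.delta finite UNIV_I if_True)
  qed
  let ?w = "transpose P *v x"
  have "x - ?E *v x = P *v (?w - ?D *v ?w)"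
    by (simp add: matrix_vector_mult_diff_distrib matrix_vector_mul_assoc matrix_mul_assoc PP
        del: transpose_matrix_vector)
  also have "\<dots> = (\<Sum>i\<in>UNIV. (if i \<in> I then ?w $ i else 0) *\<^sub>R column i P)"
    unfolding matrix_mult_sum[of P] vector_minus_component D scalar_mult_eq_scaleR
    by (intro sum.cong refl) (simp split: if_split del: transpose_matrix_vector)
  also have "\<dots> \<in> S"
    unfolding span[symmetric] by (intro span_sum) (auto intro: span_scale span_base span_zero)
  finally show "x - E *v x \<in> S"
    by (simp add: E_def)
  assume "y \<in> S"
  then have "y \<in> span ((\<lambda>i. column i P) ` I)" by (simp add: span)
  then have "orthogonal (?E *v x) y"
  proof (rule orthogonal_to_span)
    fix y assume "y \<in> (\<lambda>i. column i P) ` I"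
    then obtain i where i: "i \<in> I" "y = P *v axis i 1"
      by (auto simp: matrix_vector_mult_basis)
    have "(?E *v x) \<bullet> y = (transpose P *v (?E *v x)) \<bullet> axis i 1"
      unfolding i by (metis dot_lmul_matrix transpose_matrix_vector)
    also have "transpose P *v (?E *v x) = ?D *v ?w"
      by (simp add: matrix_vector_mul_assoc matrix_mul_assoc PP del: transpose_matrix_vector)
    also have "\<dots> \<bullet> axis i 1 = 0"
      using i by (simp add: inner_axis D)
    finally show "orthogonal (?E *v x) y"
      by (simp add: orthogonal_def)
  qed
  then show "orthogonal (E *v x) y"
    by (simp add: E_def)
qed

lemma complement_projector_adapted_basis:
  assumes "adapted_basis S P I"
  shows "complement_projector S = P ** block (- I) (- I) (mat 1) ** transpose P"
  using assms adapted_basis_projects[OF assms]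
  by (intro complement_projector_eqI) (auto simp: adapted_basis_def)

lemma
  fixes S :: "(real^'m) set"
  assumes "subspace S"
  shows diff_complement_projector_in: "x - complement_projector S *v x \<in> S" (is ?in)
    and orthogonal_complement_projector:
      "y \<in> S \<Longrightarrow> orthogonal (complement_projector S *v x) y" (is "_ \<Longrightarrow> ?orth")
    and transpose_complement_projector [simp]:
      "transpose (complement_projector S) = complement_projector S" (is ?sym)
    and complement_projector_idem [simp]:
      "complement_projector S ** complement_projector S = complement_projector S" (is ?idem)
proof -
  obtain P I where PI: "adapted_basis S P I"
    using adapted_basis_exists[OF assms] by blast
  let ?E = "P ** block (- I) (- I) (mat 1) ** transpose P"
  have E: "complement_projector S = ?E"
    using PI by (rule complement_projector_adapted_basis)
  show ?in and "y \<in> S \<Longrightarrow> ?orth"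
    unfolding E using adapted_basis_projects[OF PI] by blast+
  have D: "transpose (block (- I) (- I) (mat 1)) = (block (- I) (- I) (mat 1) :: real^'m^'m)"
    by (auto simp: transpose_def block_def mat_def vec_eq_iff)
  have DD: "block (- I) (- I) (mat 1) ** block (- I) (- I) (mat 1) = (block (- I) (- I) (mat 1) :: real^'m^'m)"
    by (simp add: vec_eq_iff block_mat_1_mult_nth) (simp add: block_def)
  show ?sym
    unfolding E by (simp add: matrix_transpose_mul D matrix_mul_assoc)
  have "?E ** ?E = P ** (block (- I) (- I) (mat 1) ** (transpose P ** P) ** block (- I) (- I) (mat 1)) ** transpose P"
    by (simp add: matrix_mul_assoc)
  also have "\<dots> = ?E"
    using PI by (simp add: adapted_basis_def orthogonal_matrix DD)
  finally show ?idem
    unfolding E .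
qed

lemma complement_projector_eq_0:
  assumes "subspace S" "y \<in> S"
  shows "complement_projector S *v y = 0"
proof -
  have "y - (y - complement_projector S *v y) \<in> S"
    by (intro subspace_diff[OF assms(1)] assms(2) diff_complement_projector_in[OF assms(1)])
  then have "orthogonal (complement_projector S *v y) (complement_projector S *v y)"
    using orthogonal_complement_projector[OF assms(1)] by simp
  then show ?thesis
    by (simp add: orthogonal_self)
qed

lemma complement_projector_0: "complement_projector {0} = mat 1"
  by (rule complement_projector_eqI) (simp_all add: orthogonal_def)

text \<open>Applied to \<open>transpose X\<close>, this is the projection onto the complement of the row space of \<open>X\<close>.\<close>

abbreviation im_perp :: "real^'n^'m \<Rightarrow> real^'m^'m" where
  "im_perp X \<equiv> complement_projector (range ((*v) X))"

lemma im_perp_0: "im_perp 0 = mat 1"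
  by (simp add: image_constant_conv complement_projector_0)

lemma transpose_0: "transpose 0 = (0 :: real^'n^'m)"
  by (simp add: transpose_def vec_eq_iff)

lemma im_perp_sym_idem [simp]:
  "transpose (im_perp X) = im_perp X" "im_perp X ** im_perp X = im_perp X"
  by (simp_all add: subspace_range_matrix)

section \<open>The tangent cones in terms of projections\<close>

lemma orthogonal_conj_inverse:
  fixes P :: "real^'m^'m" and Q :: "real^'n^'n"
  assumes "orthogonal_matrix P" "orthogonal_matrix Q"
  shows "transpose P ** (P ** A ** transpose Q) ** Q = A"
    and "P ** (transpose P ** A ** Q) ** transpose Q = A"
proof -
  have "transpose P ** (P ** A ** transpose Q) ** Q = (transpose P ** P) ** A ** (transpose Q ** Q)"
    and "P ** (transpose P ** A ** Q) ** transpose Q = (P ** transpose P) ** A ** (Q ** transpose Q)"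
    by (simp_all only: matrix_mul_assoc)
  then show "transpose P ** (P ** A ** transpose Q) ** Q = A"
    and "P ** (transpose P ** A ** Q) ** transpose Q = A"
    using assms by (simp_all add: orthogonal_matrix_def)
qed

lemma rank_orthogonal_conj:
  fixes P :: "real^'m^'m" and Q :: "real^'n^'n"
  assumes "orthogonal_matrix P" "orthogonal_matrix Q"
  shows "rank (P ** A ** transpose Q) = rank A"
proof (rule antisym)
  have le: "rank (B ** C ** D) \<le> rank C" for B :: "real^'m^'m" and C and D :: "real^'n^'n"
    using rank_mul_le_left[of "B ** C" D] rank_mul_le_right[of B C] by linarith
  then show "rank (P ** A ** transpose Q) \<le> rank A" .
  show "rank A \<le> rank (P ** A ** transpose Q)"
    using le[of "transpose P" "P ** A ** transpose Q" Q] by (simp only: orthogonal_conj_inverse[OF assms])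
qed

lemma orthogonal_conj_eq_iff:
  fixes P :: "real^'m^'m" and Q :: "real^'n^'n"
  assumes "orthogonal_matrix P" "orthogonal_matrix Q"
  shows "P ** A ** transpose Q = P ** B ** transpose Q \<longleftrightarrow> A = B"
  using orthogonal_conj_inverse(1)[OF assms] by metis

text \<open>The dictionary between blocks and projections. With \<open>E\<close> and \<open>F\<close> the projections onto the complements of the
  column space and of the row space of \<open>X\<close>, the lower right block of \<open>G\<close> is \<open>E G F\<close>, the last block column is
  \<open>G F\<close> and the last block row is \<open>E G\<close>, up to the orthogonal change of bases. Hence the upper right block
  vanishes iff \<open>G F = E G F\<close>, and the lower left one iff \<open>E G = E G F\<close>.\<close>

lemma block_conditions_iff:
  fixes X :: "real^'n^'m"
  assumes PI: "adapted_basis (range ((*v) X)) P I"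
    and QJ: "adapted_basis (range ((*v) (transpose X))) Q J"
    and G: "G = P ** M ** transpose Q"
  defines "E \<equiv> im_perp X" and "F \<equiv> im_perp (transpose X)"
  shows "rank (E ** G ** F) = rank (block (- I) (- J) M)"
    and "block I (- J) M = 0 \<longleftrightarrow> G ** F = E ** G ** F"
    and "block (- I) J M = 0 \<longleftrightarrow> E ** G = E ** G ** F"
proof -
  let ?DI = "block (- I) (- I) (mat 1) :: real^'m^'m" and ?DJ = "block (- J) (- J) (mat 1) :: real^'n^'n"
  have P: "orthogonal_matrix P" and Q: "orthogonal_matrix Q"
    using PI QJ by (auto simp: adapted_basis_def)
  then have PP: "transpose P ** P = mat 1" and QQ: "transpose Q ** Q = mat 1"
    by (auto simp: orthogonal_matrix_def)
  have E: "E = P ** ?DI ** transpose P" and F: "F = Q ** ?DJ ** transpose Q"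
    unfolding E_def F_def using PI QJ by (auto intro: complement_projector_adapted_basis)
  have "E ** G = P ** ?DI ** (transpose P ** P) ** M ** transpose Q"
    unfolding E G by (simp only: matrix_mul_assoc)
  then have EG: "E ** G = P ** (?DI ** M) ** transpose Q"
    by (simp add: PP matrix_mul_assoc)
  have "G ** F = P ** M ** (transpose Q ** Q) ** ?DJ ** transpose Q"
    unfolding F G by (simp only: matrix_mul_assoc)
  then have GF: "G ** F = P ** (M ** ?DJ) ** transpose Q"
    by (simp add: QQ matrix_mul_assoc)
  have "E ** G ** F = P ** ?DI ** M ** (transpose Q ** Q) ** ?DJ ** transpose Q"
    unfolding EG F by (simp only: matrix_mul_assoc)
  then have EGF: "E ** G ** F = P ** block (- I) (- J) M ** transpose Q"
    unfolding block_eq_mult[of "- I" "- J" M] by (simp add: QQ matrix_mul_assoc)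
  show "rank (E ** G ** F) = rank (block (- I) (- J) M)"
    unfolding EGF by (rule rank_orthogonal_conj[OF P Q])
  have nth: "block I J M $ i $ j = (if i \<in> I \<and> j \<in> J then M $ i $ j else 0)" for I J i j
    by (simp add: block_def)
  show "block I (- J) M = 0 \<longleftrightarrow> G ** F = E ** G ** F"
    unfolding EGF GF orthogonal_conj_eq_iff[OF P Q]
    unfolding vec_eq_iff mult_block_mat_1_nth nth zero_index by (intro iff_allI) auto
  show "block (- I) J M = 0 \<longleftrightarrow> E ** G = E ** G ** F"
    unfolding EGF unfolding EG orthogonal_conj_eq_iff[OF P Q]
    unfolding vec_eq_iff block_mat_1_mult_nth nth zero_index by (intro iff_allI) auto
qed

lemma orthogonal_conj_obtain:
  fixes P :: "real^'m^'m" and Q :: "real^'n^'n"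
  assumes "orthogonal_matrix P" "orthogonal_matrix Q"
  obtains M where "G = P ** M ** transpose Q"
proof
  show "G = P ** (transpose P ** G ** Q) ** transpose Q"
    by (rule orthogonal_conj_inverse(2)[OF assms, symmetric])
qed

text \<open>No separate case for \<open>X = 0\<close> remains: there both projections are the identity, and the condition reads
  \<open>rank G \<le> r\<close>.\<close>

lemma tangent_cone_eq:
  "tangent_cone r X = {G. rank (im_perp X ** G ** im_perp (transpose X)) \<le> r - rank X}"
proof (cases "X = 0")
  case True
  then show ?thesis
    by (simp add: tangent_cone_def rank_le_def im_perp_0 transpose_0 complement_projector_0)
next
  case False
  obtain P I Q J where PI: "adapted_basis (range ((*v) X)) P I"
      and QJ: "adapted_basis (range ((*v) (transpose X))) Q J"
    using adapted_basis_exists[OF subspace_range_matrix[of X]]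
      adapted_basis_exists[OF subspace_range_matrix[of "transpose X"]] by blast
  note PQ = PI[unfolded adapted_basis_def, THEN conjunct1] QJ[unfolded adapted_basis_def, THEN conjunct1]
  show ?thesis
  proof (intro equalityI subsetI)
    fix G assume "G \<in> tangent_cone r X"
    then obtain P I Q J M where G: "G = P ** M ** transpose Q"
      and PI: "adapted_basis (range ((*v) X)) P I"
      and QJ: "adapted_basis (range ((*v) (transpose X))) Q J"
      and "rank (block (- I) (- J) M) \<le> r - rank X"
      using False unfolding tangent_cone_def by auto
    then show "G \<in> {G. rank (im_perp X ** G ** im_perp (transpose X)) \<le> r - rank X}"
      using block_conditions_iff(1)[OF PI QJ G] by simp
  next
    fix G assume G: "G \<in> {G. rank (im_perp X ** G ** im_perp (transpose X)) \<le> r - rank X}"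
    obtain M where M: "G = P ** M ** transpose Q"
      using orthogonal_conj_obtain[OF PQ] by blast
    have "rank (block (- I) (- J) M) \<le> r - rank X"
      using G block_conditions_iff(1)[OF PI QJ M] by simp
    then show "G \<in> tangent_cone r X"
      unfolding tangent_cone_def if_not_P[OF False] using PI QJ M by blast
  qed
qed

lemma restricted_tangent_cone_eq:
  fixes X :: "real^'n^'m"
  defines "E \<equiv> im_perp X" and "F \<equiv> im_perp (transpose X)"
  shows "restricted_tangent_cone r X =
    {G. rank (E ** G ** F) \<le> r - rank X \<and> (G ** F = E ** G ** F \<or> E ** G = E ** G ** F)}"
    (is "_ = ?R")
proof (cases "X = 0")
  case True
  then show ?thesis
    unfolding E_def F_def
    by (simp add: restricted_tangent_cone_def rank_le_def im_perp_0 transpose_0 complement_projector_0)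
next
  case False
  obtain P I Q J where PI: "adapted_basis (range ((*v) X)) P I"
      and QJ: "adapted_basis (range ((*v) (transpose X))) Q J"
    using adapted_basis_exists[OF subspace_range_matrix[of X]]
      adapted_basis_exists[OF subspace_range_matrix[of "transpose X"]] by blast
  note PQ = PI[unfolded adapted_basis_def, THEN conjunct1] QJ[unfolded adapted_basis_def, THEN conjunct1]
  show ?thesis
  proof (intro equalityI subsetI)
    fix G assume "G \<in> restricted_tangent_cone r X"
    then obtain P I Q J M where G: "G = P ** M ** transpose Q"
      and PI: "adapted_basis (range ((*v) X)) P I"
      and QJ: "adapted_basis (range ((*v) (transpose X))) Q J"
      and "rank (block (- I) (- J) M) \<le> r - rank X" "block I (- J) M = 0 \<or> block (- I) J M = 0"
      using False unfolding restricted_tangent_cone_def by auto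
    then show "G \<in> ?R"
      using block_conditions_iff[OF PI QJ G] unfolding E_def F_def by simp
  next
    fix G assume G: "G \<in> ?R"
    obtain M where M: "G = P ** M ** transpose Q"
      using orthogonal_conj_obtain[OF PQ] by blast
    have "rank (block (- I) (- J) M) \<le> r - rank X" "block I (- J) M = 0 \<or> block (- I) J M = 0"
      using G block_conditions_iff[OF PI QJ M] unfolding E_def F_def by simp_all
    then show "G \<in> restricted_tangent_cone r X"
      unfolding restricted_tangent_cone_def if_not_P[OF False] using PI QJ M by blast
  qed
qed

text \<open>Removing its component orthogonal to the column space of \<open>X\<close> moves every column of \<open>Y\<close> into that space.\<close>

lemma rank_diff_complement_le:
  fixes Y X :: "real^'n^'m"
  shows "rank (Y - im_perp X ** Y) \<le> rank X"
proof -
  have "range ((*v) (Y - im_perp X ** Y)) \<subseteq> range ((*v) X)"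
  proof clarify
    fix x
    have "(Y - im_perp X ** Y) *v x = Y *v x - im_perp X *v (Y *v x)"
      by (simp add: matrix_vector_mult_diff_rdistrib matrix_vector_mul_assoc)
    then show "(Y - im_perp X ** Y) *v x \<in> range ((*v) X)"
      by (simp only: diff_complement_projector_in[OF subspace_range_matrix])
  qed
  then show ?thesis
    unfolding rank_dim_range by (rule dim_subset)
qed

lemma im_perp_mult_self: "im_perp X ** X = 0"
  unfolding matrix_eq
  by (simp add: complement_projector_eq_0 subspace_range_matrix flip: matrix_vector_mul_assoc)

text \<open>If the lower left block of \<open>G\<close> vanishes, the last block row of \<open>X + a G\<close> contains only the lower right block of
  \<open>a G\<close>, of rank at most \<open>r - rank X\<close>; the other rows contribute at most \<open>rank X\<close>.\<close>

lemma rank_add_im_perp_le: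
  assumes "im_perp X ** G = im_perp X ** G ** im_perp (transpose X)"
    and "rank (im_perp X ** G ** im_perp (transpose X)) \<le> r - rank X" "rank X \<le> r"
  shows "rank (X + a *\<^sub>R G) \<le> r"
proof -
  let ?Y = "X + a *\<^sub>R G" and ?E = "im_perp X"
  have "?E ** ?Y = a *\<^sub>R (?E ** G)"
    by (simp add: matrix_mult.add_right matrix_mult.scaleR_right im_perp_mult_self)
  then have "rank (?E ** ?Y) \<le> r - rank X"
    using rank_scaleR_le[of a "?E ** G"] assms by simp
  moreover have "rank ?Y \<le> rank (?Y - ?E ** ?Y) + rank (?E ** ?Y)"
    using rank_add_le[of "?Y - ?E ** ?Y" "?E ** ?Y"] by simp
  ultimately show ?thesis
    using rank_diff_complement_le[of ?Y X] assms(3) by linarith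
qed

text \<open>This is what the restriction to \<open>B = 0\<close> or \<open>C = 0\<close> buys: a step along the restricted cone, of any length, stays
  in the feasible set without any retraction. The case \<open>B = 0\<close> is the transpose of the case \<open>C = 0\<close>.\<close>

lemma rank_restricted_step_le:
  assumes "G \<in> restricted_tangent_cone r X" "rank X \<le> r"
  shows "rank (X + a *\<^sub>R G) \<le> r"
proof -
  let ?E = "im_perp X" and ?F = "im_perp (transpose X)"
  have rk: "rank (?E ** G ** ?F) \<le> r - rank X"
    and cases: "G ** ?F = ?E ** G ** ?F \<or> ?E ** G = ?E ** G ** ?F"
    using assms(1) unfolding restricted_tangent_cone_eq by auto
  show ?thesis
    using cases
  proof
    assume "?E ** G = ?E ** G ** ?F"
    then show ?thesis
      using rk assms(2) by (rule rank_add_im_perp_le)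
  next
    assume eq: "G ** ?F = ?E ** G ** ?F"
    have T: "?F ** transpose G = transpose (G ** ?F)"
      "?F ** transpose G ** ?E = transpose (?E ** G ** ?F)"
      by (simp_all add: matrix_transpose_mul matrix_mul_assoc)
    have "rank (transpose X + a *\<^sub>R transpose G) \<le> r"
    proof (rule rank_add_im_perp_le)
      show "?F ** transpose G = ?F ** transpose G ** im_perp (transpose (transpose X))"
        using T eq by simp
      show "rank (?F ** transpose G ** im_perp (transpose (transpose X))) \<le> r - rank (transpose X)"
        using T rk rank_transpose[of "im_perp X ** G ** im_perp (transpose X)"] rank_transpose[of X] by simp
    qed (use assms(2) rank_transpose[of X] in simp)
    also have "transpose X + a *\<^sub>R transpose G = transpose (X + a *\<^sub>R G)"
      by (simp add: transpose_def vec_eq_iff)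
    finally show ?thesis
      using rank_transpose[of "X + a *\<^sub>R G"] by simp
  qed
qed

section \<open>Projections onto cones\<close>

lemma metric_projectionD:
  assumes "Y \<in> metric_projection S Z"
  shows "Y \<in> S" and "W \<in> S \<Longrightarrow> norm (Z - Y) \<le> norm (Z - W)"
  using assms by (auto simp: metric_projection_def is_arg_min_def not_less)

lemma metric_projection_nonempty:
  fixes S :: "'a::euclidean_space set"
  assumes "closed S" "S \<noteq> {}"
  shows "metric_projection S Z \<noteq> {}"
proof -
  obtain Y where "Y \<in> S" "\<And>W. W \<in> S \<Longrightarrow> dist Z Y \<le> dist Z W"
    by (rule distance_attains_inf[OF assms, of Z]) blast
  then have "Y \<in> metric_projection S Z"
    by (auto simp: metric_projection_def is_arg_min_def dist_norm not_less)
  then show ?thesis by blast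
qed

text \<open>Comparison of the projection with all points of a ray of the cone. The optimal \<open>t\<close> on the ray of \<open>Y\<close> itself
  and on the ray of another \<open>W\<close> give the two inequalities below.\<close>

lemma metric_projection_scale_le:
  fixes S :: "'a::real_inner set"
  assumes S: "cone S" and Y: "Y \<in> metric_projection S Z" and W: "W \<in> S" and t: "0 \<le> t"
  shows "Y \<bullet> Y - 2 * (Z \<bullet> Y) \<le> t\<^sup>2 * (W \<bullet> W) - 2 * t * (Z \<bullet> W)"
proof -
  have "t *\<^sub>R W \<in> S"
    using S W t by (auto simp: cone_def)
  then have "norm (Z - Y) \<le> norm (Z - t *\<^sub>R W)"
    by (rule metric_projectionD(2)[OF Y])
  then have "(norm (Z - Y))\<^sup>2 \<le> (norm (Z - t *\<^sub>R W))\<^sup>2"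
    by (simp add: power_mono)
  moreover have "(norm (Z - Y))\<^sup>2 = Z \<bullet> Z - 2 * (Z \<bullet> Y) + Y \<bullet> Y"
    unfolding power2_norm_eq_inner by (simp add: inner_diff_left inner_diff_right inner_commute[of Y Z])
  moreover have "(norm (Z - t *\<^sub>R W))\<^sup>2 = Z \<bullet> Z - 2 * t * (Z \<bullet> W) + t\<^sup>2 * (W \<bullet> W)"
    unfolding power2_norm_eq_inner
    by (simp add: inner_diff_left inner_diff_right inner_commute[of W Z] power2_eq_square
        algebra_simps)
  ultimately show ?thesis by linarith
qed

lemma inner_metric_projection_self:
  fixes S :: "'a::real_inner set"
  assumes S: "cone S" and Y: "Y \<in> metric_projection S Z"
  shows "Z \<bullet> Y = (norm Y)\<^sup>2"
proof (cases "Y = 0")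
  case False
  define a b where "a = Z \<bullet> Y" and "b = Y \<bullet> Y"
  have b: "b > 0" using False by (simp add: b_def)
  have le: "b - 2 * a \<le> t\<^sup>2 * b - 2 * t * a" if "0 \<le> t" for t
    using metric_projection_scale_le[OF S Y metric_projectionD(1)[OF Y] that]
    by (simp add: a_def b_def)
  have "a \<ge> 0"
    using le[of 0] b by simp
  then have "b - 2 * a \<le> (a / b)\<^sup>2 * b - 2 * (a / b) * a"
    using le[of "a / b"] b by simp
  then have "b * (b - 2 * a) \<le> b * ((a / b)\<^sup>2 * b - 2 * (a / b) * a)"
    using b by (intro mult_left_mono) auto
  also have "\<dots> = - (a * a)"
    using b by (simp add: field_simps power2_eq_square)
  finally have "(a - b)\<^sup>2 \<le> 0"
    by (simp add: power2_eq_square algebra_simps)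
  then have "a = b" by simp
  then show ?thesis
    by (simp add: a_def b_def power2_norm_eq_inner)
qed simp

text \<open>\<open>norm Y\<close> is the largest slope of \<open>Z\<close> along the unit vectors of the cone (if \<open>Z\<close> has a positive slope at
  all). Through this, projection norms of different cones are compared, and all projections onto one cone are
  seen to have the same norm.\<close>

lemma inner_le_norm_metric_projection:
  fixes S :: "'a::real_inner set"
  assumes S: "cone S" and Y: "Y \<in> metric_projection S Z" and W: "W \<in> S"
  shows "Z \<bullet> W \<le> norm Y * norm W"
proof (cases "Z \<bullet> W \<le> 0")
  case True
  then show ?thesis
    by (smt (verit) mult_nonneg_nonneg norm_ge_zero)
next
  case False
  define a b where "a = Z \<bullet> W" and "b = W \<bullet> W"
  have a: "a > 0" using False by (simp add: a_def)
  then have b: "b > 0" by (auto simp: a_def b_def)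
  have "- (Y \<bullet> Y) \<le> (a / b)\<^sup>2 * b - 2 * (a / b) * a"
    using metric_projection_scale_le[OF S Y W, of "a / b"] a b
      inner_metric_projection_self[OF S Y]
    by (simp add: a_def b_def power2_norm_eq_inner)
  then have "b * - (Y \<bullet> Y) \<le> b * ((a / b)\<^sup>2 * b - 2 * (a / b) * a)"
    using b by (intro mult_left_mono) auto
  also have "\<dots> = - (a * a)"
    using b by (simp add: field_simps power2_eq_square)
  finally have "a * a \<le> (Y \<bullet> Y) * (W \<bullet> W)"
    by (simp add: b_def mult.commute)
  then have "a\<^sup>2 \<le> (norm Y * norm W)\<^sup>2"
    by (simp only: power_mult_distrib power2_norm_eq_inner power2_eq_square[of a])
  then show ?thesis
    unfolding a_def by (rule power2_le_imp_le) simp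
qed

lemma norm_metric_projection_le:
  fixes S :: "'a::real_inner set"
  assumes "cone S" "Y \<in> metric_projection S Z"
  shows "norm Y \<le> norm Z"
proof (cases "Y = 0")
  case False
  have "norm Y * norm Y \<le> norm Z * norm Y"
    using inner_metric_projection_self[OF assms] norm_cauchy_schwarz[of Z Y]
    by (simp add: power2_eq_square)
  with False show ?thesis by simp
qed simp

lemma norm_metric_projection_unique:
  fixes S :: "'a::real_inner set"
  assumes S: "cone S" and Y: "Y \<in> metric_projection S Z" and W: "W \<in> metric_projection S Z"
  shows "norm W = norm Y"
proof -
  have "norm W \<le> norm Y" if Y: "Y \<in> metric_projection S Z" and W: "W \<in> metric_projection S Z" for Y W
  proof (cases "W = 0")
    case False
    have "norm W * norm W \<le> norm Y * norm W"
      using inner_le_norm_metric_projection[OF S Y metric_projectionD(1)[OF W]]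
        inner_metric_projection_self[OF S W] by (simp add: power2_eq_square)
    with False show ?thesis by simp
  qed simp
  from this[OF Y W] this[OF W Y] show ?thesis
    by simp
qed

lemma projection_norm_eq:
  fixes S :: "'a::real_inner set"
  assumes "cone S" and Y: "Y \<in> metric_projection S Z"
  shows "projection_norm S Z = norm Y"
proof -
  have "norm ` metric_projection S Z = {norm Y}"
    using norm_metric_projection_unique[OF assms] Y by blast
  then show ?thesis
    by (simp add: projection_norm_def)
qed

section \<open>Comparison of the two cones\<close>

text \<open>Closedness makes the projection exist, so that \<open>stationarity\<close> is the norm of an actual projection.\<close>

lemma closed_tangent_cone: "closed (tangent_cone r (X :: real^'n^'m))"
proof -
  let ?h = "\<lambda>G. im_perp X ** G ** im_perp (transpose X)"
  have "continuous_on UNIV ?h"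
    by (intro matrix_mult.continuous_on continuous_on_const continuous_on_id)
  moreover have "tangent_cone r X = ?h -` rank_le (r - rank X)"
    by (auto simp: tangent_cone_eq rank_le_def)
  ultimately show ?thesis
    by (simp add: closed_vimage[OF closed_rank_le])
qed

lemma cone_tangent_cone: "cone (tangent_cone r X)"
  unfolding cone_def tangent_cone_eq
  by (auto simp: matrix_mult.scaleR_left matrix_mult.scaleR_right intro!: order_trans[OF rank_scaleR_le])

lemma cone_restricted_tangent_cone: "cone (restricted_tangent_cone r X)"
  unfolding cone_def restricted_tangent_cone_eq
  by (auto simp: matrix_mult.scaleR_left matrix_mult.scaleR_right intro!: order_trans[OF rank_scaleR_le])

lemma zero_in_tangent_cone: "0 \<in> tangent_cone r X"
  by (simp add: tangent_cone_eq matrix_mult.zero_left matrix_mult.zero_right)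

text \<open>\<open>Y \<mapsto> K Y L\<close> is again an orthogonal projection, now on the space of matrices; so extracting a block, or removing
  one, does not increase the norm.\<close>

lemma inner_sandwich_projectors:
  fixes Y :: "real^'n^'m"
  assumes K: "transpose K = K" "K ** K = K" and L: "transpose L = L" "L ** L = L"
  shows "(K ** Y ** L) \<bullet> Y = (norm (K ** Y ** L))\<^sup>2"
proof -
  let ?W = "K ** Y ** L"
  have KW: "K ** ?W = ?W" and WL: "?W ** L = ?W"
    using K(2) L(2) by (simp_all add: matrix_mul_assoc) (simp flip: matrix_mul_assoc)
  have "?W \<bullet> ?W = (K ** Y) \<bullet> ?W"
    by (subst inner_matrix_mult_right) (simp only: L(1) WL)
  also have "\<dots> = Y \<bullet> ?W"
    by (subst inner_matrix_mult_left) (simp only: K(1) KW)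
  finally show ?thesis
    by (simp add: power2_norm_eq_inner inner_commute)
qed

lemma norm_orthogonal_part_le:
  fixes x y :: "'a::real_inner"
  assumes "x \<bullet> y = (norm x)\<^sup>2"
  shows "norm x \<le> norm y" "norm (y - x) \<le> norm y"
proof -
  have "(norm y)\<^sup>2 = (norm x)\<^sup>2 + (norm (y - x))\<^sup>2"
    using assms unfolding power2_norm_eq_inner
    by (simp add: inner_diff_left inner_diff_right inner_commute[of y x])
  then have "(norm x)\<^sup>2 \<le> (norm y)\<^sup>2" "(norm (y - x))\<^sup>2 \<le> (norm y)\<^sup>2"
    using zero_le_power2[of "norm x"] zero_le_power2[of "norm (y - x)"] by linarith+
  then show "norm x \<le> norm y" "norm (y - x) \<le> norm y"
    by (blast intro: power2_le_imp_le norm_ge_zero)+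
qed

text \<open>Let \<open>B\<close> and \<open>C\<close> be the upper right and the lower left block of \<open>Y\<close>. The four matrices \<open>B\<close>, \<open>C\<close>, \<open>Y - B\<close>,
  \<open>Y - C\<close> belong to the restricted cone, have norm at most \<open>norm Y\<close>, and add up to \<open>2 Y\<close>. The slope of \<open>Z\<close> along
  each of them is bounded by \<open>norm G\<close>, and averaging yields the claim.\<close>

lemma norm_tangent_projection_le:
  fixes X :: "real^'n^'m"
  assumes Y: "Y \<in> metric_projection (tangent_cone r X) Z"
    and G: "G \<in> metric_projection (restricted_tangent_cone r X) Z"
  shows "norm Y \<le> 2 * norm G"
proof -
  let ?E = "im_perp X" and ?F = "im_perp (transpose X)"
  let ?E' = "mat 1 - ?E" and ?F' = "mat 1 - ?F"
  define B where "B = ?E' ** Y ** ?F"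
  define C where "C = ?E ** Y ** ?F'"
  have compl: "transpose (mat 1 - K) = mat 1 - K" "(mat 1 - K) ** (mat 1 - K) = mat 1 - K"
    if "transpose K = K" "K ** K = K" for K :: "real^'k^'k"
  proof -
    have "transpose (mat 1 - K) = transpose (mat 1) - transpose K"
      by (simp add: transpose_def vec_eq_iff)
    then show "transpose (mat 1 - K) = mat 1 - K"
      using that by simp
    show "(mat 1 - K) ** (mat 1 - K) = mat 1 - K"
      using that by (simp add: matrix_mult.diff_left matrix_mult.diff_right)
  qed
  have normB: "norm B \<le> norm Y" "norm (Y - B) \<le> norm Y"
    unfolding B_def by (intro norm_orthogonal_part_le inner_sandwich_projectors compl im_perp_sym_idem)+
  have normC: "norm C \<le> norm Y" "norm (Y - C) \<le> norm Y"
    unfolding C_def by (intro norm_orthogonal_part_le inner_sandwich_projectors compl im_perp_sym_idem)+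
  have B: "B = Y ** ?F - ?E ** Y ** ?F" and C: "C = ?E ** Y - ?E ** Y ** ?F"
    by (simp_all add: B_def C_def matrix_mult.diff_left matrix_mult.diff_right)
  have EE: "?E ** (?E ** M) = ?E ** M" for M :: "real^'n^'m"
    by (simp add: matrix_mul_assoc)
  have FF: "M ** ?F ** ?F = M ** ?F" for M :: "real^'n^'m"
    by (simp flip: matrix_mul_assoc)
  have rk: "rank (?E ** Y ** ?F) \<le> r - rank X"
    using metric_projectionD(1)[OF Y] by (simp add: tangent_cone_eq)
  have EB: "?E ** B = 0" and BF: "B ** ?F = B" and EC: "?E ** C = C" and CF: "C ** ?F = 0"
    by (simp_all add: B C matrix_mult.diff_left matrix_mult.diff_right EE FF matrix_mul_assoc)
  have YB: "(Y - B) ** ?F = ?E ** Y ** ?F" "?E ** (Y - B) = ?E ** Y"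
    by (simp_all add: matrix_mult.diff_left matrix_mult.diff_right EB BF) (simp add: B)
  have YC: "?E ** (Y - C) = ?E ** Y ** ?F"
    by (simp add: matrix_mult.diff_right EC) (simp add: C)
  have "B \<in> restricted_tangent_cone r X" "C \<in> restricted_tangent_cone r X"
    by (simp_all add: restricted_tangent_cone_eq EB EC CF matrix_mult.zero_left)
  moreover have "Y - B \<in> restricted_tangent_cone r X" "Y - C \<in> restricted_tangent_cone r X"
    using rk by (simp_all add: restricted_tangent_cone_eq YB YC FF)
  ultimately have in_cone: "{B, C, Y - B, Y - C} \<subseteq> restricted_tangent_cone r X"
    by simp
  have le: "Z \<bullet> W \<le> norm G * norm Y" if "W \<in> {B, C, Y - B, Y - C}" for W
  proof -
    have "Z \<bullet> W \<le> norm G * norm W"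
      using in_cone that by (intro inner_le_norm_metric_projection[OF cone_restricted_tangent_cone G]) auto
    also have "\<dots> \<le> norm G * norm Y"
      using normB normC that by (auto intro!: mult_left_mono)
    finally show ?thesis .
  qed
  have "2 * (norm Y)\<^sup>2 = Z \<bullet> B + Z \<bullet> C + Z \<bullet> (Y - B) + Z \<bullet> (Y - C)"
    using inner_metric_projection_self[OF cone_tangent_cone Y] by (simp add: inner_diff_right)
  also have "\<dots> \<le> 4 * (norm G * norm Y)"
    using le[of B] le[of C] le[of "Y - B"] le[of "Y - C"] by simp
  finally have "norm Y * norm Y \<le> (2 * norm G) * norm Y"
    by (simp add: power2_eq_square)
  then show ?thesis
    by (cases "Y = 0") auto
qed

lemma stationarity_le:
  assumes G: "G \<in> metric_projection (restricted_tangent_cone r X) (- gradient f X)"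
  shows "0 \<le> stationarity r f X" "stationarity r f X \<le> 2 * norm G"
proof -
  obtain Y where Y: "Y \<in> metric_projection (tangent_cone r X) (- gradient f X)"
    using metric_projection_nonempty[OF closed_tangent_cone] zero_in_tangent_cone by blast
  have "stationarity r f X = norm Y"
    unfolding stationarity_def by (rule projection_norm_eq[OF cone_tangent_cone Y])
  with norm_tangent_projection_le[OF Y G] show "0 \<le> stationarity r f X" "stationarity r f X \<le> 2 * norm G"
    by simp_all
qed

section \<open>The line search\<close>

lemma GDERIV_gradient:
  fixes f :: "'a::euclidean_space \<Rightarrow> real"
  assumes "f differentiable (at x)"
  shows "GDERIV f x :> gradient f x"
proof -
  obtain f' where f': "(f has_derivative f') (at x)"
    using assms by (auto simp: differentiable_def)
  have "f' = (\<lambda>h. h \<bullet> adjoint f' 1)"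
    using adjoint_works[OF has_derivative_linear[OF f'], of _ 1] by (simp add: fun_eq_iff)
  then have D: "GDERIV f x :> adjoint f' 1"
    unfolding gderiv_def by (rule has_derivative_eq_rhs[OF f'])
  have "D' = adjoint f' 1" if "GDERIV f x :> D'" for D'
  proof -
    have "(\<lambda>h. h \<bullet> D') = (\<lambda>h. h \<bullet> adjoint f' 1)"
      using that D unfolding gderiv_def by (rule has_derivative_unique)
    then have "\<forall>h. h \<bullet> D' = h \<bullet> adjoint f' 1"
      by (simp add: fun_eq_iff)
    then show ?thesis
      by (simp only: vector_eq_ldot)
  qed
  with D show ?thesis
    unfolding gradient_def by (rule theI)
qed

lemma backtracking_result:
  fixes \<alpha> \<beta> :: real
  assumes "while_option b (\<lambda>a. a * \<beta>) \<alpha> = Some \<alpha>'" and "0 < \<alpha>" and "0 < \<beta>"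
  shows "0 < \<alpha>' \<and> \<not> b \<alpha>' \<and> (\<alpha>' = \<alpha> \<or> (\<exists>a>0. b a \<and> \<alpha>' = a * \<beta>))"
proof -
  have "0 < \<alpha>' \<and> (\<alpha>' = \<alpha> \<or> (\<exists>a>0. b a \<and> \<alpha>' = a * \<beta>))"
    using assms(2,3)
    by (intro while_option_rule[of "\<lambda>s. 0 < s \<and> (s = \<alpha> \<or> (\<exists>a>0. b a \<and> s = a * \<beta>))", OF _ assms(1)])
       auto
  moreover have "\<not> b \<alpha>'"
    using assms(1) by (rule while_option_stop)
  ultimately show ?thesis by blast
qed

text \<open>For a trial that stays in the ball where the gradient is \<open>L\<close>-Lipschitz, the mean value theorem gives
  \<open>f (X + a G) \<le> f X - a (1 - L a) (norm G)\<^sup>2\<close>, because \<open>G\<close> has slope \<open>- (norm G)\<^sup>2\<close>. Such a trial can be rejected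
  only if it is too long.\<close>

lemma rejected_step_size_bound:
  fixes f :: "'a::euclidean_space \<Rightarrow> real"
  assumes f: "\<And>x. f differentiable (at x)"
    and lip: "L-lipschitz_on (ball Z \<epsilon>) (gradient f)"
    and X: "dist Z X < \<epsilon> / 2"
    and a: "0 < a" "a * norm G < \<epsilon> / 2"
    and desc: "gradient f X \<bullet> G = - (norm G)\<^sup>2"
    and rej: "f (X + a *\<^sub>R G) > f X - c * a * (norm G)\<^sup>2"
  shows "1 - c < L * a"
proof -
  have G: "norm G > 0"
    using rej by (cases "G = 0") auto
  have X_in: "X + t *\<^sub>R G \<in> ball Z \<epsilon>" if "0 \<le> t" "t \<le> a" for t
  proof -
    have "dist Z (X + t *\<^sub>R G) \<le> dist Z X + dist X (X + t *\<^sub>R G)"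
      by (rule dist_triangle)
    also have "dist X (X + t *\<^sub>R G) \<le> a * norm G"
      using that by (simp add: dist_norm mult_right_mono)
    finally show ?thesis
      using X a by simp
  qed
  have der: "((\<lambda>t. f (X + t *\<^sub>R G)) has_derivative (\<lambda>s. (s *\<^sub>R G) \<bullet> gradient f (X + t *\<^sub>R G)))
      (at t within {0..a})" for t
  proof (rule has_derivative_compose[of "\<lambda>t. X + t *\<^sub>R G" _ _ _ f])
    show "((\<lambda>t. X + t *\<^sub>R G) has_derivative (\<lambda>s. s *\<^sub>R G)) (at t within {0..a})"
      by (auto intro!: derivative_eq_intros)
    show "(f has_derivative (\<lambda>h. h \<bullet> gradient f (X + t *\<^sub>R G))) (at (X + t *\<^sub>R G))"
      using GDERIV_gradient[OF f] by (simp add: gderiv_def)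
  qed
  have "\<exists>t\<in>{0<..<a}. f (X + a *\<^sub>R G) - f (X + 0 *\<^sub>R G) = ((a - 0) *\<^sub>R G) \<bullet> gradient f (X + t *\<^sub>R G)"
    by (rule mvt_simple[OF a(1) der])
  then obtain t where t: "0 < t" "t < a"
    and mv: "f (X + a *\<^sub>R G) - f X = a * (G \<bullet> gradient f (X + t *\<^sub>R G))"
    by auto
  have "norm (gradient f (X + t *\<^sub>R G) - gradient f X) \<le> L * norm (t *\<^sub>R G)"
    using lipschitz_onD[OF lip X_in[of t] X_in[of 0]] t a by (simp add: dist_norm)
  then have "norm G * norm (gradient f (X + t *\<^sub>R G) - gradient f X) \<le> norm G * (L * norm (t *\<^sub>R G))"
    by (rule mult_left_mono) simp
  then have "G \<bullet> (gradient f (X + t *\<^sub>R G) - gradient f X) \<le> norm G * (L * norm (t *\<^sub>R G))"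
    by (rule order_trans[OF norm_cauchy_schwarz])
  also have "norm G * (L * norm (t *\<^sub>R G)) = L * t * (norm G)\<^sup>2"
    using t by (simp add: power2_eq_square)
  also have "\<dots> \<le> L * a * (norm G)\<^sup>2"
    using t lipschitz_on_nonneg[OF lip] by (intro mult_right_mono mult_left_mono) auto
  finally have "G \<bullet> gradient f (X + t *\<^sub>R G) \<le> (L * a - 1) * (norm G)\<^sup>2"
    using desc by (simp add: inner_diff_right inner_commute algebra_simps)
  then have "f (X + a *\<^sub>R G) - f X \<le> a * ((L * a - 1) * (norm G)\<^sup>2)"
    unfolding mv using a by (intro mult_left_mono) auto
  then have "0 < (a * (norm G)\<^sup>2) * (L * a - (1 - c))"
    using rej by (simp add: algebra_simps)
  then show ?thesis
    using zero_less_mult_pos[of "a * (norm G)\<^sup>2" "L * a - (1 - c)"] a G by simp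
qed

lemma RFD_cases:
  assumes "Y \<in> RFD f r \<alpha>lo \<alpha>hi \<beta> c X" and "0 < \<alpha>lo" "0 < \<beta>"
  obtains G \<alpha> where "G \<in> metric_projection (restricted_tangent_cone r X) (- gradient f X)"
    and "Y = X + \<alpha> *\<^sub>R G" "0 < \<alpha>" "f Y \<le> f X - c * \<alpha> * (norm G)\<^sup>2"
    and "\<alpha>lo \<le> \<alpha> \<or> (\<exists>a>0. f (X + a *\<^sub>R G) > f X - c * a * (norm G)\<^sup>2 \<and> \<alpha> = a * \<beta>)"
proof -
  obtain G \<alpha>0 \<alpha> where G: "G \<in> metric_projection (restricted_tangent_cone r X) (- gradient f X)"
    and Y: "Y = X + \<alpha> *\<^sub>R G" and \<alpha>0: "\<alpha>lo \<le> \<alpha>0"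
    and w: "while_option (\<lambda>a. f (X + a *\<^sub>R G) > f X - c * a * (norm G)\<^sup>2) (\<lambda>a. a * \<beta>) \<alpha>0 = Some \<alpha>"
    using assms(1) by (auto simp: RFD_def)
  have res: "0 < \<alpha> \<and> \<not> f (X + \<alpha> *\<^sub>R G) > f X - c * \<alpha> * (norm G)\<^sup>2 \<and>
      (\<alpha> = \<alpha>0 \<or> (\<exists>a>0. f (X + a *\<^sub>R G) > f X - c * a * (norm G)\<^sup>2 \<and> \<alpha> = a * \<beta>))"
    by (rule backtracking_result[OF w]) (use assms(2,3) \<alpha>0 in auto)
  show ?thesis
  proof (rule that[OF G Y])
    show "f Y \<le> f X - c * \<alpha> * (norm G)\<^sup>2"
      using res unfolding Y by linarith
    show "\<alpha>lo \<le> \<alpha> \<or> (\<exists>a>0. f (X + a *\<^sub>R G) > f X - c * a * (norm G)\<^sup>2 \<and> \<alpha> = a * \<beta>)"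
      using res \<alpha>0 by blast
  qed (use res in blast)
qed

text \<open>Near a given point \<open>Z\<close> the accepted step sizes are bounded away from 0: a rejected trial is either longer than
  \<open>(1 - c) / L\<close>, or it leaves a fixed ball, which is impossible for short trials since \<open>norm G\<close> is bounded by the
  norm of the gradient. With sufficient decrease and \<open>norm G \<ge> stationarity / 2\<close>, every step from a point near
  \<open>Z\<close> lowers \<open>f\<close> by a fixed multiple of the squared stationarity measure. Both
  constants are uniform in the rank of the point, which may vary near \<open>Z\<close>.\<close>

lemma RFD_local_decrease:
  fixes f :: "real^'n^'m \<Rightarrow> real"
  assumes f: "\<And>Z. f differentiable (at Z)" and lip: "locally_Lipschitz (gradient f)"
    and \<alpha>lo: "0 < \<alpha>lo" and \<beta>: "0 < \<beta>" and c: "0 < c" "c < 1"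
  shows "\<exists>\<rho>>0. \<exists>\<kappa>>0. \<forall>X \<in> ball Z \<rho>. \<forall>Y \<in> RFD f r \<alpha>lo \<alpha>hi \<beta> c X.
    f Y \<le> f X - \<kappa> * (stationarity r f X)\<^sup>2"
proof -
  obtain \<epsilon> L where \<epsilon>: "0 < \<epsilon>" and L: "L-lipschitz_on (ball Z \<epsilon>) (gradient f)"
    using lip unfolding locally_Lipschitz_def by blast
  have L0: "0 \<le> L" using L by (rule lipschitz_on_nonneg)
  \<comment> \<open>A bound on the gradient over the ball around \<open>Z\<close>, positive by the summand 1.\<close>
  define g where "g = norm (gradient f Z) + L * \<epsilon> + 1"
  have g: "0 < g"
    using L0 \<epsilon> by (simp add: g_def add_nonneg_pos)
  have grad_le: "norm (gradient f X) \<le> g" if "dist Z X < \<epsilon>" for X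
  proof -
    have "dist (gradient f X) (gradient f Z) \<le> L * dist X Z"
      using lipschitz_onD[OF L] that \<epsilon> by (simp add: dist_commute)
    moreover have "L * dist X Z \<le> L * \<epsilon>"
      using L0 that by (intro mult_left_mono) (auto simp: dist_commute)
    moreover have "norm (gradient f X) \<le> norm (gradient f Z) + dist (gradient f X) (gradient f Z)"
      unfolding dist_norm by (rule norm_triangle_sub)
    ultimately show ?thesis by (simp add: g_def)
  qed
  \<comment> \<open>\<open>L + 1\<close> replaces \<open>L\<close>, which may be 0.\<close>
  define a0 where "a0 = min ((1 - c) / (L + 1)) (\<epsilon> / (2 * g))"
  have a0: "0 < a0" using L0 c \<epsilon> g by (simp add: a0_def)
  \<comment> \<open>The factor 4 is the square of the constant 2 that relates the two cones.\<close>
  define \<kappa> where "\<kappa> = c * min \<alpha>lo (a0 * \<beta>) / 4"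
  have \<kappa>: "0 < \<kappa>" using c \<alpha>lo a0 \<beta> by (simp add: \<kappa>_def)
  have "f Y \<le> f X - \<kappa> * (stationarity r f X)\<^sup>2"
    if X: "X \<in> ball Z (\<epsilon> / 2)" and Y: "Y \<in> RFD f r \<alpha>lo \<alpha>hi \<beta> c X" for X Y
  proof -
    obtain G \<alpha> where G: "G \<in> metric_projection (restricted_tangent_cone r X) (- gradient f X)"
      and \<alpha>: "f Y \<le> f X - c * \<alpha> * (norm G)\<^sup>2" "0 < \<alpha>"
        "\<alpha>lo \<le> \<alpha> \<or> (\<exists>a>0. f (X + a *\<^sub>R G) > f X - c * a * (norm G)\<^sup>2 \<and> \<alpha> = a * \<beta>)"
      using RFD_cases[OF Y \<alpha>lo \<beta>] by blast
    have dX: "dist Z X < \<epsilon> / 2" using X by simp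
    have "norm G \<le> norm (- gradient f X)"
      by (rule norm_metric_projection_le[OF cone_restricted_tangent_cone G])
    then have Gg: "norm G \<le> g"
      using grad_le[of X] dX \<epsilon> by simp
    have desc: "gradient f X \<bullet> G = - (norm G)\<^sup>2"
      using inner_metric_projection_self[OF cone_restricted_tangent_cone G] by simp
    have "a0 \<le> a" if a: "0 < a" and rej: "f (X + a *\<^sub>R G) > f X - c * a * (norm G)\<^sup>2" for a
    proof (rule ccontr)
      assume "\<not> a0 \<le> a"
      then have small: "a < (1 - c) / (L + 1)" "a < \<epsilon> / (2 * g)"
        by (auto simp: a0_def)
      have "a * norm G \<le> a * g"
        using a Gg by simp
      also have "\<dots> < \<epsilon> / 2"
        using small(2) g by (simp add: field_simps)
      finally have "1 - c < L * a"
        by (rule rejected_step_size_bound[OF f L dX a _ desc rej])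
      moreover have "(L + 1) * a < 1 - c"
        using small(1) L0 by (simp add: field_simps)
      ultimately show False
        using a by (simp add: algebra_simps)
    qed
    then have "min \<alpha>lo (a0 * \<beta>) \<le> \<alpha>"
      using \<alpha>(3) \<beta> by (auto simp: min_le_iff_disj)
    moreover have "(stationarity r f X)\<^sup>2 \<le> (2 * norm G)\<^sup>2"
      using stationarity_le[OF G] by (intro power_mono)
    ultimately have "min \<alpha>lo (a0 * \<beta>) * (stationarity r f X)\<^sup>2 \<le> \<alpha> * (2 * norm G)\<^sup>2"
      using \<alpha>(2) by (intro mult_mono) auto
    then have "c * (min \<alpha>lo (a0 * \<beta>) * (stationarity r f X)\<^sup>2) \<le> c * (\<alpha> * (2 * norm G)\<^sup>2)"
      using c by (intro mult_left_mono) auto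
    then have "\<kappa> * (stationarity r f X)\<^sup>2 \<le> c * \<alpha> * (norm G)\<^sup>2"
      by (simp add: \<kappa>_def power_mult_distrib)
    with \<alpha>(1) show ?thesis by linarith
  qed
  then show ?thesis
    using \<epsilon> \<kappa> by (intro exI[of _ "\<epsilon> / 2"] conjI exI[of _ \<kappa>]) auto
qed

lemma RFD_rank_le:
  assumes "Y \<in> RFD f r \<alpha>lo \<alpha>hi \<beta> c X" "rank X \<le> r"
  shows "rank Y \<le> r"
  using assms rank_restricted_step_le metric_projectionD(1) unfolding RFD_def by blast

lemma RFDR_rank_le:
  assumes "Y \<in> RFDR f r \<alpha>lo \<alpha>hi \<beta> c \<Delta> X" "rank X \<le> r"
  shows "rank Y \<le> r"
proof -
  obtain X1 where X1: "X1 \<in> RFD f r \<alpha>lo \<alpha>hi \<beta> c X"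
    and Y: "Y = X1 \<or> (\<exists>Xhat \<in> metric_projection (rank_eq (r - 1)) X. Y \<in> RFD f r \<alpha>lo \<alpha>hi \<beta> c Xhat)"
    using assms(1) unfolding RFDR_def is_arg_min_def by (auto split: if_splits)
  from Y show ?thesis
  proof
    assume "Y = X1"
    then show ?thesis using RFD_rank_le[OF X1 assms(2)] by simp
  next
    assume "\<exists>Xhat \<in> metric_projection (rank_eq (r - 1)) X. Y \<in> RFD f r \<alpha>lo \<alpha>hi \<beta> c Xhat"
    then obtain Xhat where Xhat: "Xhat \<in> metric_projection (rank_eq (r - 1)) X"
      and Y: "Y \<in> RFD f r \<alpha>lo \<alpha>hi \<beta> c Xhat" by blast
    have "rank Xhat = r - 1"
      using metric_projectionD(1)[OF Xhat] by (simp add: rank_eq_def)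
    then show ?thesis
      by (intro RFD_rank_le[OF Y]) simp
  qed
qed

text \<open>The rank reduction only offers a second candidate, so it can only improve on the plain step.\<close>

lemma RFDR_le_RFD:
  assumes "Y \<in> RFDR f r \<alpha>lo \<alpha>hi \<beta> c \<Delta> X"
  shows "\<exists>X1 \<in> RFD f r \<alpha>lo \<alpha>hi \<beta> c X. f Y \<le> f X1"
proof -
  obtain X1 where X1: "X1 \<in> RFD f r \<alpha>lo \<alpha>hi \<beta> c X"
    and "Y = X1 \<or> (\<exists>X2. is_arg_min f (\<lambda>W. W \<in> {X1, X2}) Y)"
    using assms unfolding RFDR_def by (auto split: if_splits)
  then have "f Y \<le> f X1"
    by (auto simp: is_arg_min_def not_less)
  with X1 show ?thesis by blast
qed

section \<open>Convergence of descent sequences\<close>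

lemma local_decrease_imp_decseq:
  fixes x :: "nat \<Rightarrow> 'a::metric_space" and f s :: "'a \<Rightarrow> real"
  assumes dec: "\<And>z. \<exists>\<rho>>0. \<exists>\<kappa>>0. \<forall>i. x i \<in> ball z \<rho> \<longrightarrow> f (x (Suc i)) \<le> f (x i) - \<kappa> * (s (x i))\<^sup>2"
  shows "decseq (\<lambda>i. f (x i))"
proof (rule decseq_SucI)
  fix i
  obtain \<rho> \<kappa> where "0 < \<rho>" "0 < \<kappa>"
    "x i \<in> ball (x i) \<rho> \<Longrightarrow> f (x (Suc i)) \<le> f (x i) - \<kappa> * (s (x i))\<^sup>2"
    using dec[of "x i"] by blast
  then have "f (x (Suc i)) \<le> f (x i) - \<kappa> * (s (x i))\<^sup>2" "0 \<le> \<kappa> * (s (x i))\<^sup>2"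
    by simp_all
  then show "f (x (Suc i)) \<le> f (x i)" by linarith
qed

text \<open>The abstract convergence argument. Along the subsequence the values of \<open>f\<close> tend to \<open>f L\<close> by continuity, hence by
  monotonicity along the whole sequence. So the decrease of \<open>f\<close> in a single step tends to 0, and it dominates
  \<open>\<kappa> s\<^sup>2\<close> as soon as the subsequence is near \<open>L\<close>. The function \<open>s\<close>
  may be discontinuous at \<open>L\<close>, as the stationarity measure can be where the rank drops; this is why the
  conclusion is about its values along the subsequence instead of \<open>s L\<close>.\<close>

lemma descent_along_convergent_subsequence:
  fixes x :: "nat \<Rightarrow> 'a::metric_space" and f s :: "'a \<Rightarrow> real"
  assumes cont: "\<And>z. isCont f z"
    and dec: "\<And>z. \<exists>\<rho>>0. \<exists>\<kappa>>0. \<forall>i. x i \<in> ball z \<rho> \<longrightarrow> f (x (Suc i)) \<le> f (x i) - \<kappa> * (s (x i))\<^sup>2"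
    and \<phi>: "strict_mono \<phi>" and conv: "(\<lambda>k. x (\<phi> k)) \<longlonglongrightarrow> L"
  shows "(\<lambda>i. f (x i)) \<longlonglongrightarrow> f L" and "(\<lambda>k. s (x (\<phi> k))) \<longlonglongrightarrow> 0"
proof -
  have anti: "decseq (\<lambda>i. f (x i))"
    using dec by (rule local_decrease_imp_decseq)
  have sub: "(\<lambda>k. f (x (\<phi> k))) \<longlonglongrightarrow> f L"
    by (rule isCont_tendsto_compose[OF cont conv])
  have "f L \<le> f (x (\<phi> k))" for k
    using anti \<phi> by (intro decseq_ge[OF _ sub]) (auto simp: decseq_def strict_mono_less_eq)
  then have "f L \<le> f (x i)" for i
    by (rule order_trans[OF _ decseqD[OF anti seq_suble[OF \<phi>]]])
  then obtain l where l: "(\<lambda>i. f (x i)) \<longlonglongrightarrow> l"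
    using decseq_convergent[OF anti, of "f L"] by blast
  then have "l = f L"
    using LIMSEQ_subseq_LIMSEQ[OF l \<phi>] LIMSEQ_unique[OF _ sub] by (simp add: comp_def)
  with l show lim: "(\<lambda>i. f (x i)) \<longlonglongrightarrow> f L" by simp
  obtain \<rho> \<kappa> where \<rho>: "0 < \<rho>" and \<kappa>: "0 < \<kappa>"
    and step: "\<And>i. x i \<in> ball L \<rho> \<Longrightarrow> f (x (Suc i)) \<le> f (x i) - \<kappa> * (s (x i))\<^sup>2"
    using dec[of L] by blast
  have near: "\<forall>\<^sub>F k in sequentially. x (\<phi> k) \<in> ball L \<rho>"
    using topological_tendstoD[OF conv open_ball, of L \<rho>] \<rho> by simp
  have gap: "(\<lambda>k. (f (x (\<phi> k)) - f (x (Suc (\<phi> k)))) / \<kappa>) \<longlonglongrightarrow> (f L - f L) / \<kappa>"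
    using LIMSEQ_subseq_LIMSEQ[OF LIMSEQ_Suc[OF lim] \<phi>] sub \<kappa>
    by (intro tendsto_intros) (auto simp: comp_def)
  have "(\<lambda>k. (s (x (\<phi> k)))\<^sup>2) \<longlonglongrightarrow> 0"
  proof (rule tendsto_sandwich[OF _ _ tendsto_const])
    show "(\<lambda>k. (f (x (\<phi> k)) - f (x (Suc (\<phi> k)))) / \<kappa>) \<longlonglongrightarrow> 0"
      using gap by simp
    show "\<forall>\<^sub>F k in sequentially. (s (x (\<phi> k)))\<^sup>2 \<le> (f (x (\<phi> k)) - f (x (Suc (\<phi> k)))) / \<kappa>"
      using near
    proof eventually_elim
      case (elim k)
      then show ?case
        using step[OF elim] \<kappa> by (simp add: pos_le_divide_eq mult.commute)
    qed
  qed simp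
  then show "(\<lambda>k. s (x (\<phi> k))) \<longlonglongrightarrow> 0"
    by (simp add: power_tendsto_0_iff)
qed

lemma infinitely_often_bounded_imp_convergent_subsequence:
  fixes x :: "nat \<Rightarrow> 'a::heine_borel"
  assumes inf: "infinite {i. x i \<in> B}" and B: "bounded B"
  obtains \<phi> L where "strict_mono \<phi>" "\<And>k. x (\<phi> k) \<in> B" "(\<lambda>k. x (\<phi> k)) \<longlonglongrightarrow> L"
proof -
  obtain \<psi> :: "nat \<Rightarrow> nat" where \<psi>: "strict_mono \<psi>" "\<And>k. x (\<psi> k) \<in> B"
    using infinite_enumerate[OF inf] by blast
  have "bounded (range (\<lambda>k. x (\<psi> k)))"
    using B \<psi>(2) by (auto intro: bounded_subset)
  then obtain L \<theta> where "strict_mono \<theta>" "((\<lambda>k. x (\<psi> k)) \<circ> \<theta>) \<longlonglongrightarrow> L"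
    using bounded_imp_convergent_subsequence by blast
  then show ?thesis
    using \<psi> by (intro that[of "\<psi> \<circ> \<theta>" L]) (auto simp: comp_def strict_mono_def)
qed

text \<open>Otherwise \<open>s\<close> stays away from 0 along some subsequence, and by compactness along a convergent one.\<close>

lemma tendsto_0_if_along_convergent_subsequences:
  fixes x :: "nat \<Rightarrow> 'a::heine_borel" and s :: "'a \<Rightarrow> real"
  assumes bdd: "bounded (range x)"
    and sub: "\<And>\<phi> L. strict_mono \<phi> \<Longrightarrow> (\<lambda>k. x (\<phi> k)) \<longlonglongrightarrow> L \<Longrightarrow> (\<lambda>k. s (x (\<phi> k))) \<longlonglongrightarrow> 0"
  shows "(\<lambda>i. s (x i)) \<longlonglongrightarrow> 0"
proof (rule ccontr)
  assume "\<not> (\<lambda>i. s (x i)) \<longlonglongrightarrow> 0"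
  then obtain e where e: "0 < e" "\<not> (\<exists>N. \<forall>i\<ge>N. \<bar>s (x i)\<bar> < e)"
    by (auto simp: LIMSEQ_def)
  let ?B = "{z \<in> range x. e \<le> \<bar>s z\<bar>}"
  have "infinite {i. x i \<in> ?B}"
    unfolding infinite_nat_iff_unbounded_le using e(2) by (auto simp: not_less)
  moreover have "bounded ?B"
    using bdd by (rule bounded_subset) auto
  ultimately obtain \<phi> L where \<phi>: "strict_mono \<phi>" "\<And>k. x (\<phi> k) \<in> ?B" "(\<lambda>k. x (\<phi> k)) \<longlonglongrightarrow> L"
    using infinitely_often_bounded_imp_convergent_subsequence by blast
  have "(\<lambda>k. \<bar>s (x (\<phi> k))\<bar>) \<longlonglongrightarrow> 0"
    using sub[OF \<phi>(1,3)] by (rule tendsto_rabs_zero)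
  then have "e \<le> 0"
    using \<phi>(2) by (intro LIMSEQ_le_const) auto
  with e(1) show False by simp
qed

text \<open>A finite limit inferior means that infinitely many terms lie in one ball, to which Bolzano-Weierstrass applies.\<close>

lemma accumulation_point_iff_liminf_norm:
  fixes x :: "nat \<Rightarrow> 'a::euclidean_space"
  shows "(\<exists>L. accumulation_point x L) \<longleftrightarrow> liminf (\<lambda>i. ereal (norm (x i))) < \<infinity>"
proof
  assume "\<exists>L. accumulation_point x L"
  then obtain L \<phi> where \<phi>: "strict_mono \<phi>" "(x \<circ> \<phi>) \<longlonglongrightarrow> L"
    by (auto simp: accumulation_point_def)
  have "(\<lambda>k. ereal (norm (x (\<phi> k)))) \<longlonglongrightarrow> ereal (norm L)"
    using tendsto_norm[OF \<phi>(2)] by (simp add: comp_def)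
  then have "liminf ((\<lambda>i. ereal (norm (x i))) \<circ> \<phi>) = ereal (norm L)"
    by (simp add: comp_def lim_imp_Liminf)
  then have "liminf (\<lambda>i. ereal (norm (x i))) \<le> ereal (norm L)"
    using liminf_subseq_mono[OF \<phi>(1), of "\<lambda>i. ereal (norm (x i))"] by simp
  then show "liminf (\<lambda>i. ereal (norm (x i))) < \<infinity>"
    by (rule le_less_trans) simp
next
  assume "liminf (\<lambda>i. ereal (norm (x i))) < \<infinity>"
  then obtain C where C: "liminf (\<lambda>i. ereal (norm (x i))) < ereal C"
    using ereal_dense2 by blast
  have "infinite {i. x i \<in> cball 0 C}"
  proof
    assume "finite {i. x i \<in> cball 0 C}"
    then have "\<forall>\<^sub>F i in cofinite. x i \<notin> cball 0 C"
      by (simp add: eventually_cofinite)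
    then have "\<forall>\<^sub>F i in sequentially. ereal C \<le> ereal (norm (x i))"
      unfolding cofinite_eq_sequentially by eventually_elim simp
    then have "ereal C \<le> liminf (\<lambda>i. ereal (norm (x i)))"
      by (rule Liminf_bounded)
    with C show False by simp
  qed
  then obtain \<phi> L where "strict_mono \<phi>" "(\<lambda>k. x (\<phi> k)) \<longlonglongrightarrow> L"
    using infinitely_often_bounded_imp_convergent_subsequence[OF _ bounded_cball] by metis
  then show "\<exists>L. accumulation_point x L"
    by (auto simp: accumulation_point_def comp_def)
qed

theorem corollary6p3:
  fixes f :: "real^'n^'m \<Rightarrow> real"
    and r :: nat
    and \<alpha>lo \<alpha>hi \<beta> c \<Delta> :: real
    and X0 :: "real^'n^'m"
    and X :: "nat \<Rightarrow> real^'n^'m"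
  assumes r: "1 \<le> r" "r < min CARD('m) CARD('n)"
    and f_diff: "\<And>Z. f differentiable (at Z)"
    and grad_lip: "locally_Lipschitz (gradient f)"
    and alpha: "0 < \<alpha>lo" "\<alpha>lo \<le> \<alpha>hi"
    and beta: "\<beta> \<in> {0<..<1}"
    and c: "c \<in> {0<..<1}"
    and Delta: "0 < \<Delta>"
    and X0: "X0 \<in> rank_le r" "X 0 = X0"
    and nonstationary: "\<And>i. stationarity r f (X i) > 0"
    and step: "\<And>i. X (Suc i) \<in> RFDR f r \<alpha>lo \<alpha>hi \<beta> c \<Delta> (X i)"
  shows "((\<exists>L. accumulation_point X L) \<longleftrightarrow> liminf (\<lambda>i. ereal (norm (X i))) < \<infinity>)
    \<and> (\<forall>\<phi>. strict_mono \<phi> \<longrightarrow> convergent (X \<circ> \<phi>) \<longrightarrow>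
          (\<lambda>k. stationarity r f (X (\<phi> k))) \<longlonglongrightarrow> 0)
    \<and> (bounded (range X) \<longrightarrow>
          (\<lambda>i. stationarity r f (X i)) \<longlonglongrightarrow> 0 \<and>
          (\<forall>L L'. accumulation_point X L \<longrightarrow> accumulation_point X L' \<longrightarrow> f L = f L'))
    \<and> (bounded {Z \<in> rank_le r. f Z \<le> f X0} \<longrightarrow> bounded (range X))"
proof -
  have cont: "isCont f Z" for Z
    using f_diff by (rule differentiable_imp_continuous_within)
  have dec: "\<exists>\<rho>>0. \<exists>\<kappa>>0. \<forall>i. X i \<in> ball Z \<rho> \<longrightarrow>
      f (X (Suc i)) \<le> f (X i) - \<kappa> * (stationarity r f (X i))\<^sup>2" for Z
  proof -
    obtain \<rho> \<kappa> where "0 < \<rho>" "0 < \<kappa>" and RFD: "\<And>W Y. W \<in> ball Z \<rho> \<Longrightarrow>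
        Y \<in> RFD f r \<alpha>lo \<alpha>hi \<beta> c W \<Longrightarrow> f Y \<le> f W - \<kappa> * (stationarity r f W)\<^sup>2"
      using RFD_local_decrease[OF f_diff grad_lip alpha(1), of \<beta> c Z r \<alpha>hi] beta c by auto
    moreover have "f (X (Suc i)) \<le> f (X i) - \<kappa> * (stationarity r f (X i))\<^sup>2" if "X i \<in> ball Z \<rho>" for i
      using RFDR_le_RFD[OF step[of i]] RFD[OF that] by (meson order_trans)
    ultimately show ?thesis by blast
  qed
  note descent = descent_along_convergent_subsequence[OF cont dec]
  have limits: "(\<lambda>i. f (X i)) \<longlonglongrightarrow> f L" if "accumulation_point X L" for L
    using that descent(1) by (auto simp: accumulation_point_def comp_def)
  have "rank (X i) \<le> r" for i
    using X0 by (induction i) (auto simp: rank_le_def intro: RFDR_rank_le[OF step])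
  moreover have "f (X i) \<le> f X0" for i
    using decseqD[OF local_decrease_imp_decseq[OF dec], of 0 i] X0(2) by simp
  ultimately have sublevel: "range X \<subseteq> {Z \<in> rank_le r. f Z \<le> f X0}"
    by (auto simp: rank_le_def)
  show ?thesis
  proof (intro conjI allI impI)
    show "(\<exists>L. accumulation_point X L) \<longleftrightarrow> liminf (\<lambda>i. ereal (norm (X i))) < \<infinity>"
      by (rule accumulation_point_iff_liminf_norm)
    show "(\<lambda>k. stationarity r f (X (\<phi> k))) \<longlonglongrightarrow> 0"
      if "strict_mono \<phi>" "convergent (X \<circ> \<phi>)" for \<phi>
      using that descent(2) by (auto simp: convergent_def comp_def)
    show "(\<lambda>i. stationarity r f (X i)) \<longlonglongrightarrow> 0" if "bounded (range X)"
      using that descent(2) by (rule tendsto_0_if_along_convergent_subsequences)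
    show "f L = f L'" if "accumulation_point X L" "accumulation_point X L'" for L L'
      using limits[OF that(1)] limits[OF that(2)] by (rule LIMSEQ_unique)
    show "bounded (range X)" if "bounded {Z \<in> rank_le r. f Z \<le> f X0}"
      using that sublevel by (rule bounded_subset)
  qed
qed

end
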